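(* Let $p$ be a prime and let $G$ be a finite metabelian $p$-group (i.e. $G''=1$) which is semi-$p$-abelian. Then $G$ is strongly semi-$p$-abelian.
   Context: Let $G$ be a finite $p$-group. For a positive integer $i$, $G$ is called semi-$p^{i}$-abelian if for all $a,b\in G$: $(ab)^{p^{i}}=1$ if and only if $a^{p^{i}}b^{p^{i}}=1$; semi-$p$-abelian means semi-$p^1$-abelian. $G$ is called strongly semi-$p$-abelian if it is semi-$p^{i}$-abelian for every positive integer $i$. *)

theory Defs
  imports "HOL-Algebra.Algebra"
begin

definition semi_pi_abelian :: "('a, 'b) monoid_scheme \<Rightarrow> nat \<Rightarrow> nat \<Rightarrow> bool" where
  "semi_pi_abelian G p i \<longleftrightarrow>
     (\<forall>a\<in>carrier G. \<forall>b\<in>carrier G.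
        (a \<otimes>\<^bsub>G\<^esub> b) [^]\<^bsub>G\<^esub> (p ^ i) = \<one>\<^bsub>G\<^esub> \<longleftrightarrow>
        (a [^]\<^bsub>G\<^esub> (p ^ i)) \<otimes>\<^bsub>G\<^esub> (b [^]\<^bsub>G\<^esub> (p ^ i)) = \<one>\<^bsub>G\<^esub>)"

definition strongly_semi_p_abelian :: "('a, 'b) monoid_scheme \<Rightarrow> nat \<Rightarrow> bool" where
  "strongly_semi_p_abelian G p \<longleftrightarrow> (\<forall>i::nat. i \<ge> 1 \<longrightarrow> semi_pi_abelian G p i)"

end

(*
Write [a, b] = w and view the abelian group G' as a module over Z[A, B], where A and B act as
conjugation by a and b. In a semi-p-abelian group (g t)^p = g^p holds iff t^p = 1. For t = f w this
says that the norm 1 + g + ... + g^(p-1) kills f w iff p does. If z = a^p b^p (or z = a^p) has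
order p, then p^2 kills w, and (g z)^p = g^p yields relations, for g = a^k b, which can be separated
by a Vandermonde argument modulo p. They say that p times every monomial of degree p - 2 in A - 1
and B - 1 kills w. The metabelian power formula (a b)^p = a^p b^p (E w)^(-1), with E the sum of
A^k B^i over k < i < p, has E in the (p-2)nd power of the augmentation ideal modulo p. Hence the
error term has order p, and G is semi-p^2-abelian. Passing to the quotients by the subgroups
{x. x^(p^i) = 1} gives all higher powers.
*)

theory Submission
  imports "HOL-Computational_Algebra.Polynomial" Defs
begin

section \<open>Sums of powers and powers of an ideal with two generators\<close>

text \<open>The norm of \<open>G\<close> equals \<open>(G - 1)^(p-1)\<close> only modulo
  \<open>p\<close>, and \<open>p\<close> need not kill \<open>w\<close>, so nothing can be read
  directly over the field with \<open>p\<close> elements. The relations are therefore applied only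
  to elements \<open>t\<close> such that \<open>p t\<close> annihilates \<open>w\<close>. On these
  the \<open>(p-1)\<close>st power of the augmentation ideal acts as zero, and once
  \<open>p^2\<close> kills \<open>w\<close> the norms of \<open>A\<close> and \<open>B\<close> are
  such elements. Errors of degree \<open>p - 1\<close> are then negligible:
  \<open>A^k B^l - 1\<close> may be replaced by the linear form
  \<open>k (A - 1) + l (B - 1)\<close>, the relations become polynomials in \<open>k\<close>, and
  Vandermonde applies. That \<open>p^2\<close> kills \<open>w\<close> comes from
  \<open>a^(p^2)\<close> being trivial or inverse to a power of \<open>b\<close>, hence commuting
  with \<open>b\<close>. The two choices of \<open>z\<close> serve the two implications:
  \<open>a^p b^p\<close> for one, and the first factor's power in \<open>a = (a b) b^(-1)\<close>
  for the other. \<open>A\<close> and \<open>B\<close> are indeterminates because the estimate of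
  \<open>E\<close> divides by \<open>A - 1\<close>, which is legitimate in an integral
  domain.\<close>

definition psum :: "nat \<Rightarrow> 'r::comm_ring_1 \<Rightarrow> 'r" where
  "psum n G = (\<Sum>i<n. G ^ i)"

lemma psum_0 [simp]: "psum 0 G = 0" by (simp add: psum_def)

lemma psum_Suc: "psum (Suc n) G = psum n G + G ^ n" by (simp add: psum_def)

lemma psum_mult_diff: "(G - 1) * psum n G = G ^ n - 1"
  by (simp add: psum_def power_diff_1_eq)

text \<open>This is \<open>((1 + g)^n - 1) / g\<close>; induction with Pascal's rule avoids dividing
  by \<open>g\<close>, which may be a zero divisor.\<close>

lemma psum_binomial: "psum n (1 + g) = (\<Sum>r<n. of_nat (n choose Suc r) * g ^ r)"
proof (induction n)
  case (Suc n)
  have "(1 + g) ^ n = (\<Sum>r\<le>n. of_nat (n choose r) * g ^ r)"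
    using binomial_ring[of g 1 n] by (simp add: add.commute)
  then have "psum (Suc n) (1 + g) = (\<Sum>r<Suc n. of_nat (n choose Suc r) * g ^ r)
      + (\<Sum>r<Suc n. of_nat (n choose r) * g ^ r)"
    using Suc by (simp add: psum_Suc binomial_eq_0 lessThan_Suc_atMost[symmetric])
  also have "\<dots> = (\<Sum>r<Suc n. of_nat (Suc n choose Suc r) * g ^ r)"
    by (simp add: sum.distrib[symmetric] algebra_simps)
  finally show ?case .
qed simp

lemma psum_psum_binomial:
  "(\<Sum>i<n. psum i (1 + g)) = (\<Sum>r<n. of_nat (n choose Suc (Suc r)) * g ^ r)"
proof (induction n)
  case (Suc n)
  have "(\<Sum>i<Suc n. psum i (1 + g)) = (\<Sum>r<Suc n. of_nat (n choose Suc (Suc r)) * g ^ r)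
      + (\<Sum>r<Suc n. of_nat (n choose Suc r) * g ^ r)"
    using Suc psum_binomial[of n g] by (simp add: binomial_eq_0)
  also have "\<dots> = (\<Sum>r<Suc n. of_nat (Suc n choose Suc (Suc r)) * g ^ r)"
    by (simp add: sum.distrib[symmetric] algebra_simps)
  finally show ?case .
qed simp

text \<open>Here \<open>c\<close> stands for a shifted row of Pascal's triangle at a prime, where
  only the final coefficient survives modulo \<open>p\<close>.\<close>

lemma sum_multiple_plus_last:
  fixes c :: "nat \<Rightarrow> nat" and f :: "nat \<Rightarrow> 'r::comm_ring_1"
  assumes "\<And>r. r < m \<Longrightarrow> p dvd c r" and "c m = 1"
  obtains U where "(\<Sum>r<Suc m. of_nat (c r) * f r) = f m + of_nat p * U"
proof -
  have "(of_nat (c r) :: 'r) = of_nat p * of_nat (c r div p)" if "r < m" for r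
    using assms(1)[OF that] by (metis dvd_mult_div_cancel of_nat_mult)
  then have "(\<Sum>r<m. of_nat (c r) * f r) = of_nat p * (\<Sum>r<m. of_nat (c r div p) * f r)"
    unfolding sum_distrib_left by (intro sum.cong) (auto simp: mult.assoc)
  with assms(2) show ?thesis by (intro that) (auto simp: add.commute)
qed

lemma psum_prime:
  fixes G :: "'r::comm_ring_1"
  assumes "Factorial_Ring.prime p"
  obtains U where "psum p G = (G - 1) ^ (p - 1) + of_nat p * U"
proof -
  have p: "Suc (p - 1) = p" using assms by (simp add: prime_gt_0_nat)
  obtain U where "(\<Sum>r<Suc (p - 1). of_nat (p choose Suc r) * (G - 1) ^ r) = (G - 1) ^ (p - 1) + of_nat p * U"
    by (rule sum_multiple_plus_last[where m="p - 1" and p=p and c="\<lambda>r. p choose Suc r" and f="\<lambda>r. (G - 1) ^ r"])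
      (use assms p in \<open>auto intro!: dvd_choose_prime\<close>)
  with psum_binomial[of p "G - 1"] p that show thesis by auto
qed

text \<open>The source of the degree \<open>p - 2\<close>: summing the partial norms shifts the
  binomial coefficients once more, so the surviving power is one lower than for the norm.\<close>

lemma psum_psum_prime:
  fixes G :: "'r::comm_ring_1"
  assumes "Factorial_Ring.prime p"
  obtains U where "(\<Sum>i<p. psum i G) = (G - 1) ^ (p - 2) + of_nat p * U"
proof -
  have p: "p \<ge> 2" using assms by (simp add: prime_ge_2_nat)
  obtain U where U: "(\<Sum>r<Suc (p - 2). of_nat (p choose Suc (Suc r)) * (G - 1) ^ r) = (G - 1) ^ (p - 2) + of_nat p * U"
    by (rule sum_multiple_plus_last[where m="p - 2" and p=p and c="\<lambda>r. p choose Suc (Suc r)" and f="\<lambda>r. (G - 1) ^ r"])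
      (use assms p in \<open>auto intro!: dvd_choose_prime simp: Suc_diff_Suc numeral_2_eq_2\<close>)
  \<comment> \<open>The extra index \<open>p - 1\<close> carries the coefficient
    \<open>p choose (p + 1)\<close>, which is zero.\<close>
  have "{..<p} = insert (p - 1) {..<Suc (p - 2)}" using p by auto
  then have "(\<Sum>r<p. of_nat (p choose Suc (Suc r)) * (G - 1) ^ r) = (\<Sum>r<Suc (p - 2). of_nat (p choose Suc (Suc r)) * (G - 1) ^ r)"
    using p by (simp add: binomial_eq_0)
  with U psum_psum_binomial[of "G - 1" p] that show thesis by auto
qed

section \<open>Powers of the ideal generated by \<open>x\<close> and \<open>y\<close>, and leading
  forms\<close>

primrec Jpow :: "'r::comm_ring_1 \<Rightarrow> 'r \<Rightarrow> nat \<Rightarrow> 'r set" where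
  "Jpow x y 0 = UNIV"
| "Jpow x y (Suc n) = {x * f + y * g | f g. f \<in> Jpow x y n \<and> g \<in> Jpow x y n}"

declare Jpow.simps(2) [simp del]

lemma Jpow_SucI: "f \<in> Jpow x y n \<Longrightarrow> g \<in> Jpow x y n \<Longrightarrow> x * f + y * g \<in> Jpow x y (Suc n)"
  by (auto simp: Jpow.simps(2))

lemma Jpow_SucE:
  assumes "h \<in> Jpow x y (Suc n)"
  obtains f g where "h = x * f + y * g" "f \<in> Jpow x y n" "g \<in> Jpow x y n"
  using assms by (auto simp: Jpow.simps(2))

lemma Jpow_add: "f \<in> Jpow x y n \<Longrightarrow> g \<in> Jpow x y n \<Longrightarrow> f + g \<in> Jpow x y n"
proof (induction n arbitrary: f g)
  case (Suc n)
  from Suc.prems(1) obtain f1 f2 where f: "f = x * f1 + y * f2" "f1 \<in> Jpow x y n" "f2 \<in> Jpow x y n"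
    by (rule Jpow_SucE)
  from Suc.prems(2) obtain g1 g2 where g: "g = x * g1 + y * g2" "g1 \<in> Jpow x y n" "g2 \<in> Jpow x y n"
    by (rule Jpow_SucE)
  have "x * (f1 + g1) + y * (f2 + g2) \<in> Jpow x y (Suc n)"
    using f g by (intro Jpow_SucI Suc.IH)
  moreover have "f + g = x * (f1 + g1) + y * (f2 + g2)" by (simp add: f(1) g(1) algebra_simps)
  ultimately show ?case by simp
qed simp

lemma Jpow_mult_left: "g \<in> Jpow x y n \<Longrightarrow> f * g \<in> Jpow x y n"
proof (induction n arbitrary: g)
  case (Suc n)
  from Suc.prems obtain g1 g2 where g: "g = x * g1 + y * g2" "g1 \<in> Jpow x y n" "g2 \<in> Jpow x y n"
    by (rule Jpow_SucE)
  have "x * (f * g1) + y * (f * g2) \<in> Jpow x y (Suc n)"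
    using g by (intro Jpow_SucI Suc.IH)
  moreover have "f * g = x * (f * g1) + y * (f * g2)" by (simp add: g(1) algebra_simps)
  ultimately show ?case by simp
qed simp

lemma Jpow_0_mem [simp]: "0 \<in> Jpow x y n"
  by (induction n) (use Jpow_SucI[of 0 x y _ 0] in auto)

lemma Jpow_sum: "(\<And>i. i \<in> S \<Longrightarrow> f i \<in> Jpow x y n) \<Longrightarrow> sum f S \<in> Jpow x y n"
  by (induction S rule: infinite_finite_induct) (auto intro: Jpow_add)

lemma Jpow_Suc_subset: "f \<in> Jpow x y (Suc n) \<Longrightarrow> f \<in> Jpow x y n"
  by (erule Jpow_SucE) (auto intro: Jpow_add Jpow_mult_left)

lemma Jpow_mult: "f \<in> Jpow x y m \<Longrightarrow> g \<in> Jpow x y n \<Longrightarrow> f * g \<in> Jpow x y (m + n)"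
proof (induction m arbitrary: f)
  case 0
  then show ?case by (simp add: Jpow_mult_left)
next
  case (Suc m)
  from Suc.prems(1) obtain f1 f2 where f: "f = x * f1 + y * f2" "f1 \<in> Jpow x y m" "f2 \<in> Jpow x y m"
    by (rule Jpow_SucE)
  have "x * (f1 * g) + y * (f2 * g) \<in> Jpow x y (Suc (m + n))"
    by (intro Jpow_SucI Suc.IH[OF f(2) Suc.prems(2)] Suc.IH[OF f(3) Suc.prems(2)])
  moreover have "f * g = x * (f1 * g) + y * (f2 * g)" by (simp add: f(1) algebra_simps)
  ultimately show ?case by simp
qed

lemma Jpow_1 [simp]: "x \<in> Jpow x y (Suc 0)" "y \<in> Jpow x y (Suc 0)"
  using Jpow_SucI[of 1 x y 0 0] Jpow_SucI[of 0 x y 0 1] by auto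

lemma Jpow_power: "f \<in> Jpow x y (Suc 0) \<Longrightarrow> f ^ n \<in> Jpow x y n"
proof (induction n)
  case (Suc n)
  then show ?case using Jpow_mult[of f x y "Suc 0" "f ^ n" n] by simp
qed simp

lemma Jpow_monomial: "x ^ i * y ^ j \<in> Jpow x y (i + j)"
  by (intro Jpow_mult Jpow_power Jpow_1)

text \<open>Replacing one factor \<open>u\<close> by \<open>v\<close> changes the product by a term
  with one factor of degree two and \<open>n - 1\<close> factors of degree one.\<close>

lemma Jpow_power_diff:
  assumes "u \<in> Jpow x y (Suc 0)" "v \<in> Jpow x y (Suc 0)" "u - v \<in> Jpow x y 2"
  shows "u ^ n - v ^ n \<in> Jpow x y (Suc n)"
proof (induction n)
  case 0
  show ?case by simp
next
  case (Suc n)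
  have "u ^ Suc n - v ^ Suc n = (u - v) * u ^ n + v * (u ^ n - v ^ n)" by (simp add: algebra_simps)
  moreover have "(u - v) * u ^ n \<in> Jpow x y (2 + n)"
    by (rule Jpow_mult[OF assms(3) Jpow_power[OF assms(1)]])
  moreover have "v * (u ^ n - v ^ n) \<in> Jpow x y (Suc 0 + Suc n)"
    by (rule Jpow_mult[OF assms(2) Suc])
  ultimately show ?case by (auto intro: Jpow_add)
qed

lemma power_linear: "(1 + x) ^ k - 1 - of_nat k * x \<in> Jpow x y 2"
proof (induction k)
  case (Suc k)
  have x2: "x * x \<in> Jpow x y 2"
    using Jpow_mult[OF Jpow_1(1) Jpow_1(1), of x y] by (simp add: numeral_2_eq_2)
  have "(1 + x) ^ Suc k - 1 - of_nat (Suc k) * x = (1 + x) * ((1 + x) ^ k - 1 - of_nat k * x) + of_nat k * (x * x)"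
    by (simp add: algebra_simps)
  then show ?case using Suc x2 by (auto intro: Jpow_add Jpow_mult_left)
qed simp

lemma Jpow_swap: "Jpow x y n = Jpow y x n"
  by (induction n) (auto simp: Jpow.simps(2), metis add.commute, metis add.commute)

text \<open>With \<open>x = A - 1\<close> and \<open>y = B - 1\<close> this is the leading form of
  \<open>A^k B^l - 1\<close>. It turns exponents into coefficients, which makes the later relations
  polynomial in \<open>k\<close>.\<close>

lemma monomial_linear:
  "(1 + x) ^ k * (1 + y) ^ l - 1 - (of_nat k * x + of_nat l * y) \<in> Jpow x y 2"
proof -
  let ?u = "(1 + x) ^ k - 1 - of_nat k * x" and ?v = "(1 + y) ^ l - 1 - of_nat l * y"
  have u: "?u \<in> Jpow x y 2" by (rule power_linear)
  have v: "?v \<in> Jpow x y 2" using power_linear[of y l x] Jpow_swap by blast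
  have xy: "x * y \<in> Jpow x y 2"
    using Jpow_mult[OF Jpow_1, of x y] by (simp add: numeral_2_eq_2)
  have "(1 + x) ^ k * (1 + y) ^ l - 1 - (of_nat k * x + of_nat l * y)
     = (1 + y) ^ l * ?u + (1 + of_nat k * x) * ?v + of_nat k * of_nat l * (x * y)"
    by (simp add: algebra_simps)
  then show ?thesis by (simp only:) (intro Jpow_add Jpow_mult_left u v xy)
qed

section \<open>Ideals and separation of coefficients modulo a prime\<close>

locale ring_ideal =
  fixes I :: "'r::comm_ring_1 set"
  assumes zero_I: "0 \<in> I"
    and add_I: "f \<in> I \<Longrightarrow> g \<in> I \<Longrightarrow> f + g \<in> I"
    and mult_I: "f \<in> I \<Longrightarrow> h * f \<in> I"
begin

lemma mult_I': "f \<in> I \<Longrightarrow> f * h \<in> I"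
  using mult_I by (simp add: mult.commute)

lemma diff_I: "f \<in> I \<Longrightarrow> g \<in> I \<Longrightarrow> f - g \<in> I"
  using add_I[of f "- 1 * g"] mult_I[of g "- 1"] by simp

lemma cong_I: "f - g \<in> I \<Longrightarrow> f \<in> I \<longleftrightarrow> g \<in> I"
  using add_I[of "f - g" g] diff_I[of f "f - g"] by auto

lemma sum_I: "(\<And>i. i \<in> S \<Longrightarrow> f i \<in> I) \<Longrightarrow> sum f S \<in> I"
  by (induction S rule: infinite_finite_induct) (auto intro: add_I zero_I)

lemma coprime_cancel_I:
  fixes m :: int
  assumes "coprime m (int p)" "of_int m * f \<in> I" "of_nat p * f \<in> I"
  shows "f \<in> I"
proof -
  obtain u v where "u * m + v * int p = 1"
    using assms(1) by (metis bezout_int coprime_imp_gcd_eq_1)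
  then have "of_int (u * m + v * int p) * f = f" by simp
  moreover have "of_int (u * m + v * int p) * f = of_int u * (of_int m * f) + of_int v * (of_nat p * f)"
    by (simp add: algebra_simps)
  ultimately show ?thesis using assms add_I mult_I by metis
qed

text \<open>Membership needs testing on monomials only. The induction moves one generator at a time
  into \<open>t\<close>, so \<open>t\<close> has to vary.\<close>

lemma Jpow_mult_I:
  assumes "\<And>i. i \<le> n \<Longrightarrow> x ^ i * y ^ (n - i) * t \<in> I" "f \<in> Jpow x y n"
  shows "f * t \<in> I"
  using assms
proof (induction n arbitrary: f t)
  case 0
  then show ?case using mult_I[of t f] by (auto)
next
  case (Suc n)
  obtain f1 f2 where f: "f = x * f1 + y * f2" "f1 \<in> Jpow x y n" "f2 \<in> Jpow x y n"
    using Suc.prems(2) by (rule Jpow_SucE)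
  have "f1 * (x * t) \<in> I"
  proof (rule Suc.IH[OF _ f(2)])
    show "x ^ i * y ^ (n - i) * (x * t) \<in> I" if "i \<le> n" for i
      using Suc.prems(1)[of "Suc i"] that by (simp add: mult_ac)
  qed
  moreover have "f2 * (y * t) \<in> I"
  proof (rule Suc.IH[OF _ f(3)])
    show "x ^ i * y ^ (n - i) * (y * t) \<in> I" if "i \<le> n" for i
      using Suc.prems(1)[of i] that by (simp add: Suc_diff_le mult_ac)
  qed
  ultimately show ?case using add_I[of "f1 * (x * t)" "f2 * (y * t)"] by (simp add: f(1) algebra_simps)
qed

text \<open>Modulo \<open>I\<close> the \<open>c i\<close> are vectors over the field with
  \<open>p\<close> elements, and a polynomial of degree below \<open>card K\<close> with
  \<open>card K\<close> roots distinct modulo \<open>p\<close> vanishes. Instead of inverting a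
  determinant, the induction splits off one root \<open>k\<close>; the factor \<open>l - k\<close>
  left at another node \<open>l\<close> is a unit modulo \<open>p\<close>.\<close>

lemma vandermonde_set:
  fixes K :: "int set"
  assumes "finite K" "Factorial_Ring.prime p"
    and "\<And>k k'. k \<in> K \<Longrightarrow> k' \<in> K \<Longrightarrow> k \<noteq> k' \<Longrightarrow> \<not> int p dvd k - k'"
    and "\<And>k. k \<in> K \<Longrightarrow> (\<Sum>i<card K. of_int k ^ i * c i) \<in> I"
    and "\<And>i. i < card K \<Longrightarrow> of_nat p * c i \<in> I"
  shows "\<forall>i < card K. c i \<in> I"
  using assms(1,3-)
proof (induction K arbitrary: c rule: finite_induct)
  case (insert k K)
  define n where "n = card K"
  have n: "card (insert k K) = Suc n" using insert.hyps by (simp add: n_def)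
  \<comment> \<open>The \<open>d i\<close> are the coefficients of the quotient by
    \<open>X - k\<close> in synthetic division; the remainder is \<open>c 0 + k d 0\<close>.\<close>
  define d where "d i = (\<Sum>j\<in>{Suc i..n}. of_int k ^ (j - Suc i) * c j)" for i
  have d_rec: "d i = c (Suc i) + of_int k * d (Suc i)" if "i < n" for i
  proof -
    have "d i = c (Suc i) + (\<Sum>j\<in>{Suc (Suc i)..n}. of_int k ^ (j - Suc i) * c j)"
      unfolding d_def using that by (subst sum.atLeast_Suc_atMost) auto
    also have "(\<Sum>j\<in>{Suc (Suc i)..n}. of_int k ^ (j - Suc i) * c j) = of_int k * d (Suc i)"
      unfolding d_def sum_distrib_left
      by (intro sum.cong) (auto simp: mult.assoc[symmetric] power_Suc[symmetric] Suc_diff_Suc simp del: power_Suc)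
    finally show ?thesis .
  qed
  have dn: "d n = 0" by (simp add: d_def)
  have pd: "of_nat p * d i \<in> I" for i
    unfolding d_def sum_distrib_left
  proof (rule sum_I)
    fix j assume "j \<in> {Suc i..n}"
    then have "of_nat p * c j \<in> I" using insert.prems(3)[of j] n by auto
    then show "of_nat p * (of_int k ^ (j - Suc i) * c j) \<in> I"
      using mult_I[of "of_nat p * c j" "of_int k ^ (j - Suc i)"] by (simp add: mult_ac)
  qed
  have shift: "(\<Sum>i<Suc n. of_int l ^ i * c i) = (\<Sum>i<n. of_int l ^ i * c (Suc i) * of_int l) + c 0" for l
    by (subst sum.lessThan_Suc_shift) (simp add: mult_ac)
  have horner: "(\<Sum>i<Suc n. of_int l ^ i * c i)
      = of_int (l - k) * (\<Sum>i<n. of_int l ^ i * d i) + (c 0 + of_int k * d 0)" for l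
  proof -
    have tel: "(\<Sum>i<n. of_int l ^ Suc i * d (Suc i)) = (\<Sum>i<n. of_int l ^ i * d i) - d 0"
      using sum.lessThan_Suc_shift[of "\<lambda>i. of_int l ^ i * d i" n] dn by simp
    have "(\<Sum>i<n. of_int l ^ i * c (Suc i) * of_int l)
        = (\<Sum>i<n. of_int l * (of_int l ^ i * d i) - of_int k * (of_int l ^ Suc i * d (Suc i)))"
      by (intro sum.cong) (auto simp: d_rec algebra_simps)
    also have "\<dots> = of_int l * (\<Sum>i<n. of_int l ^ i * d i) - of_int k * ((\<Sum>i<n. of_int l ^ i * d i) - d 0)"
      unfolding tel[symmetric] by (simp add: sum_subtractf sum_distrib_left)
    finally show ?thesis unfolding shift by (simp add: algebra_simps)
  qed
  have c0: "c 0 + of_int k * d 0 \<in> I"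
    using insert.prems(2)[of k] horner[of k] n by simp
  have "\<forall>i < card K. d i \<in> I"
  proof (rule insert.IH)
    show "\<not> int p dvd l - l'" if "l \<in> K" "l' \<in> K" "l \<noteq> l'" for l l'
      using insert.prems(1) that by blast
    show "of_nat p * d i \<in> I" for i by (rule pd)
    fix l assume l: "l \<in> K"
    then have "coprime (l - k) (int p)"
      using insert.prems(1)[of l k] insert.hyps(2) assms(2)
      by (metis insertCI prime_imp_coprime coprime_commute prime_nat_int_transfer)
    moreover have "of_int (l - k) * (\<Sum>i<n. of_int l ^ i * d i) \<in> I"
      using insert.prems(2)[of l] l c0 diff_I unfolding n horner by fastforce
    moreover have "of_nat p * (\<Sum>i<n. of_int l ^ i * d i) \<in> I"
      unfolding sum_distrib_left
    proof (rule sum_I)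
      show "of_nat p * (of_int l ^ i * d i) \<in> I" for i
        using mult_I[OF pd, of "of_int l ^ i" i] by (simp add: mult_ac)
    qed
    ultimately show "(\<Sum>i<card K. of_int l ^ i * d i) \<in> I"
      unfolding n_def[symmetric] by (rule coprime_cancel_I)
  qed
  then have d: "d i \<in> I" if "i \<le> n" for i
    using that dn zero_I by (cases "i = n") (auto simp: n_def)
  show ?case
  proof (intro allI impI)
    fix i assume "i < card (insert k K)"
    then have "i \<le> n" using n by simp
    show "c i \<in> I"
    proof (cases i)
      case 0
      then show ?thesis using c0 diff_I[OF c0 mult_I[OF d[of 0], of "of_int k"]] by simp
    next
      case (Suc j)
      then show ?thesis using diff_I[OF d[of j] mult_I[OF d[of "Suc j"], of "of_int k"]] d_rec[of j] \<open>i \<le> n\<close> by simp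
    qed
  qed
qed simp

lemma vandermonde:
  assumes p: "Factorial_Ring.prime p"
    and sum: "\<And>k. (\<Sum>i<p. of_nat k ^ i * c i) \<in> I"
    and pc: "\<And>i. i < p \<Longrightarrow> of_nat p * c i \<in> I"
    and i: "i < p"
  shows "c i \<in> I"
proof -
  have card: "card (int ` {..<p}) = p" by (simp add: card_image)
  have "\<forall>i < card (int ` {..<p}). c i \<in> I"
  proof (rule vandermonde_set[OF _ p])
    fix k k' assume "k \<in> int ` {..<p}" "k' \<in> int ` {..<p}" "k \<noteq> k'"
    then have "\<bar>k - k'\<bar> < int p" "k - k' \<noteq> 0" by auto
    then show "\<not> int p dvd k - k'" using zdvd_not_zless[of "\<bar>k - k'\<bar>" "int p"] by auto
  qed (use sum pc card in auto)
  with card i show ?thesis by simp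
qed

end

section \<open>The annihilator of a commutator\<close>

text \<open>The properties of the annihilator \<open>I\<close> of \<open>[a, b]\<close> in the ring \<open>\<int>[A, B]\<close>, where \<open>A\<close> and \<open>B\<close>
  stand for conjugation by \<open>a\<close> and \<open>b\<close>. The elements \<open>t\<close> with \<open>p t \<in> I\<close> correspond to the
  elements of order \<open>p\<close> among the \<open>f [a, b]\<close>. The axiom \<open>rel\<close> says that the element
  \<open>z = a\<^sup>p b\<^bsup>p \<delta>\<^esup>\<close> of order \<open>p\<close> satisfies \<open>(g z)\<^sup>p = g\<^sup>p\<close> for \<open>g = a\<^sup>k b\<close>.\<close>

locale power_ideal = ring_ideal I for I :: "'r::comm_ring_1 set" +
  fixes A B :: 'r and p \<delta> :: nat
  assumes p: "Factorial_Ring.prime p"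
    and p2: "of_nat p * of_nat p \<in> I"
    and psum_I: "psum p (A ^ k * B ^ l) * f \<in> I \<longleftrightarrow> of_nat p * f \<in> I"
    and rel: "(psum p A - of_nat \<delta> * B * psum p B * psum k A) * (\<Sum>i<p. psum i (A ^ k * B)) \<in> I"
begin

abbreviation "x \<equiv> A - 1"
abbreviation "y \<equiv> B - 1"
abbreviation "J \<equiv> Jpow (A - 1) (B - 1)"

lemma p_ge_2: "p \<ge> 2" using p by (simp add: prime_ge_2_nat)

lemma psum_A_I: "psum p A * f \<in> I \<longleftrightarrow> of_nat p * f \<in> I"
  using psum_I[of 1 0 f] by simp

lemma psum_B_I: "psum p B * f \<in> I \<longleftrightarrow> of_nat p * f \<in> I"
  using psum_I[of 0 1 f] by simp

lemma monomial_linear_J: "A ^ k * B ^ l - 1 - (of_nat k * x + of_nat l * y) \<in> J 2"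
  using monomial_linear[of x k y l] by simp

lemma linear_J: "of_nat k * x + of_nat l * y \<in> J (Suc 0)"
  by (intro Jpow_add Jpow_mult_left Jpow_1)

lemma monomial_J: "A ^ k * B ^ l - 1 \<in> J (Suc 0)"
  using Jpow_add[OF Jpow_Suc_subset linear_J[of k l], OF monomial_linear_J[of k l, unfolded numeral_2_eq_2]]
  by simp

text \<open>On \<open>t\<close> the term \<open>p U\<close> of the norm disappears, so the norm of
  \<open>A^k B^l\<close> acts as \<open>(A^k B^l - 1)^(p-1)\<close>.\<close>

lemma power_monomial_I:
  assumes "of_nat p * t \<in> I"
  shows "(A ^ k * B ^ l - 1) ^ (p - 1) * t \<in> I"
proof -
  let ?G = "A ^ k * B ^ l"
  obtain U where U: "psum p ?G = (?G - 1) ^ (p - 1) + of_nat p * U"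
    using psum_prime[OF p] .
  have "psum p ?G * t - (?G - 1) ^ (p - 1) * t = U * (of_nat p * t)"
    unfolding U by (simp add: algebra_simps)
  then show ?thesis
    using cong_I[of "psum p ?G * t" "(?G - 1) ^ (p - 1) * t"] mult_I[OF assms, of U] psum_I assms by simp
qed

lemma linear_power_I:
  assumes "\<And>f. f \<in> J (Suc n) \<Longrightarrow> f * t \<in> I" "(A ^ k * B ^ l - 1) ^ n * t \<in> I"
  shows "(of_nat k * x + of_nat l * y) ^ n * t \<in> I"
proof -
  have "((A ^ k * B ^ l - 1) ^ n - (of_nat k * x + of_nat l * y) ^ n) * t \<in> I"
    by (intro assms(1) Jpow_power_diff monomial_J linear_J monomial_linear_J)
  then show ?thesis
    using cong_I[of "(A ^ k * B ^ l - 1) ^ n * t" "(of_nat k * x + of_nat l * y) ^ n * t"] assms(2)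
    by (simp add: algebra_simps)
qed

lemma coprime_choose:
  assumes "n < p" "i \<le> n" shows "coprime (int (n choose i)) (int p)"
proof -
  have "\<not> p dvd (n choose i)"
  proof
    assume "p dvd (n choose i)"
    then have "p dvd fact n"
      using binomial_fact_lemma[OF assms(2)] by (metis dvd_mult)
    then show False using p assms(1) by (simp add: prime_dvd_fact_iff)
  qed
  then show ?thesis
    using p by (simp add: prime_imp_coprime coprime_commute)
qed

lemma linear_power_expand:
  "(of_nat k * x + of_nat 1 * y) ^ n = (\<Sum>i\<le>n. of_nat k ^ i * (of_nat (n choose i) * x ^ i * y ^ (n - i)))"
  by (simp add: binomial_ring power_mult_distrib mult_ac)

text \<open>The power \<open>(k x + y)\<^bsup>p - 1\<^esup> t\<close> lies in \<open>I\<close> for all \<open>k\<close>, so a Vandermonde argument separates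
  its monomials.\<close>

lemma J_power_I_step:
  assumes t: "of_nat p * t \<in> I" and J: "\<And>f. f \<in> J p \<Longrightarrow> f * t \<in> I" and i: "i \<le> p - 1"
  shows "x ^ i * y ^ (p - 1 - i) * t \<in> I"
proof -
  have pp: "Suc (p - 1) = p" using p_ge_2 by simp
  have pI: "of_nat p * (f * t) \<in> I" for f
    using mult_I[OF t, of f] by (simp add: mult_ac)
  have "of_nat ((p - 1) choose i) * x ^ i * y ^ (p - 1 - i) * t \<in> I"
  proof (rule vandermonde[OF p, where c="\<lambda>i. of_nat ((p - 1) choose i) * x ^ i * y ^ (p - 1 - i) * t"])
    show "of_nat p * (of_nat (p - 1 choose i) * x ^ i * y ^ (p - 1 - i) * t) \<in> I" for i by (rule pI)
    show "i < p" using i p_ge_2 by simp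
    fix k
    have "(of_nat k * x + of_nat 1 * y) ^ (p - 1) * t \<in> I"
      using J pp by (intro linear_power_I power_monomial_I t) simp_all
    then show "(\<Sum>i<p. of_nat k ^ i * (of_nat (p - 1 choose i) * x ^ i * y ^ (p - 1 - i) * t)) \<in> I"
      using pp unfolding linear_power_expand sum_distrib_right
      by (metis (no_types, lifting) lessThan_Suc_atMost mult.assoc sum.cong)
  qed
  then have "of_int (int ((p - 1) choose i)) * (x ^ i * y ^ (p - 1 - i) * t) \<in> I"
    by (simp add: mult.assoc)
  moreover have "coprime (int ((p - 1) choose i)) (int p)"
    using i p_ge_2 by (intro coprime_choose) simp_all
  ultimately show ?thesis by (blast intro: coprime_cancel_I pI)
qed

text \<open>Descending induction on the degree. In degree \<open>2 (p - 1)\<close> every monomial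
  contains \<open>x^(p-1)\<close> or \<open>y^(p-1)\<close>. Below that, a factor \<open>r\<close>
  of degree \<open>n\<close> is split off, and the separation of monomials in degree
  \<open>p - 1\<close> is applied to \<open>r t\<close> instead of \<open>t\<close>.\<close>

lemma J_power_I_aux:
  assumes "of_nat p * t \<in> I" "f \<in> J (p - 1 + n)" "n \<le> p - 1"
  shows "f * t \<in> I"
  using assms(3,1,2)
proof (induction n arbitrary: f t rule: inc_induct)
  case base
  show ?case
  proof (rule Jpow_mult_I[OF _ base(2)])
    fix i assume i: "i \<le> p - 1 + (p - 1)"
    have x: "x ^ (p - 1) * t \<in> I" using power_monomial_I[of t 1 0] base(1) by simp
    have y: "y ^ (p - 1) * t \<in> I" using power_monomial_I[of t 0 1] base(1) by simp
    show "x ^ i * y ^ (p - 1 + (p - 1) - i) * t \<in> I"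
    proof (cases "p - 1 \<le> i")
      case True
      then have "x ^ i = x ^ (i - (p - 1)) * x ^ (p - 1)" by (simp add: power_add[symmetric])
      then show ?thesis using mult_I[OF x, of "x ^ (i - (p - 1)) * y ^ (p - 1 + (p - 1) - i)"]
        by (simp only: mult_ac)
    next
      case False
      then have "y ^ (p - 1 + (p - 1) - i) = y ^ ((p - 1) - i) * y ^ (p - 1)"
        by (simp add: power_add[symmetric])
      then show ?thesis using mult_I[OF y, of "x ^ i * y ^ ((p - 1) - i)"]
        by (simp only: mult_ac)
    qed
  qed
next
  case (step n)
  show ?case
  proof (rule Jpow_mult_I[OF _ step.prems(2)])
    fix i assume i: "i \<le> p - 1 + n"
    define j where "j = min i (p - 1)"
    define r where "r = x ^ (i - j) * y ^ (n - (i - j))"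
    have eq: "x ^ i * y ^ (p - 1 + n - i) * t = x ^ j * y ^ (p - 1 - j) * (r * t)"
    proof -
      have "i = j + (i - j)" "p - 1 + n - i = (p - 1 - j) + (n - (i - j))"
        using i by (auto simp: j_def)
      then have "x ^ i * y ^ (p - 1 + n - i) = (x ^ j * x ^ (i - j)) * (y ^ (p - 1 - j) * y ^ (n - (i - j)))"
        by (metis power_add)
      then show ?thesis by (simp add: r_def mult_ac)
    qed
    have "x ^ j * y ^ (p - 1 - j) * (r * t) \<in> I"
    proof (rule J_power_I_step)
      show "of_nat p * (r * t) \<in> I"
        using mult_I[OF step.prems(1), of r] by (simp add: mult_ac)
      show "j \<le> p - 1" by (simp add: j_def)
      \<comment> \<open>The product \<open>f r\<close> has degree
        \<open>p + n = p - 1 + Suc n\<close>, which the induction hypothesis covers.\<close>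
      fix f assume f: "f \<in> J p"
      have "(i - j) + (n - (i - j)) = n" using i by (auto simp: j_def)
      then have "r \<in> J n" unfolding r_def by (metis Jpow_monomial)
      from Jpow_mult[OF f this] have "f * r \<in> J (p - 1 + Suc n)"
        using p_ge_2 by simp
      then show "f * (r * t) \<in> I"
        using step.IH[OF step.prems(1), of "f * r"] by (simp only: mult.assoc)
    qed
    then show "x ^ i * y ^ (p - 1 + n - i) * t \<in> I" by (simp only: eq)
  qed
qed

lemma J_power_I:
  assumes "of_nat p * t \<in> I" "f \<in> J (p - 1)"
  shows "f * t \<in> I"
  using J_power_I_aux[of t f 0] assms by simp

lemma p_psum_I: "of_nat p * psum p A \<in> I" "of_nat p * psum p B \<in> I"
  using psum_A_I[of "of_nat p"] psum_B_I[of "of_nat p"] p2 by (simp_all add: mult.commute)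

text \<open>This is \<open>rel\<close> reduced to leading forms. The double sum is
  \<open>(G - 1)^(p-2)\<close> modulo \<open>p\<close>, and \<open>J (p - 1)\<close> kills whatever
  \<open>p\<close> kills. Hence \<open>G - 1\<close> becomes \<open>k x + y\<close> and
  \<open>B * psum k A\<close> becomes \<open>k\<close>, leaving a polynomial of degree at most
  \<open>p - 1\<close> in \<open>k\<close>.\<close>

lemma rel_linear:
  "(of_nat k * x + of_nat 1 * y) ^ (p - 2) * (psum p A - of_nat k * (of_nat \<delta> * psum p B)) \<in> I"
proof -
  let ?G = "A ^ k * B ^ 1" and ?L = "of_nat k * x + of_nat 1 * y"
  let ?z = "psum p A - of_nat \<delta> * B * psum p B * psum k A"
  have pz: "of_nat p * ?z \<in> I"
    using diff_I[OF p_psum_I(1) mult_I[OF p_psum_I(2), of "of_nat \<delta> * B * psum k A"]]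
    by (simp add: algebra_simps)
  obtain U where U: "(\<Sum>i<p. psum i ?G) = (?G - 1) ^ (p - 2) + of_nat p * U"
    using psum_psum_prime[OF p] .
  have "?z * (\<Sum>i<p. psum i ?G) - (?G - 1) ^ (p - 2) * ?z = U * (of_nat p * ?z)"
    unfolding U by (simp only: algebra_simps)
  then have "(?G - 1) ^ (p - 2) * ?z \<in> I"
    using cong_I[of "?z * (\<Sum>i<p. psum i ?G)" "(?G - 1) ^ (p - 2) * ?z"] mult_I[OF pz, of U] rel[of k] by simp
  moreover have "f * ?z \<in> I" if "f \<in> J (Suc (p - 2))" for f
    using J_power_I[OF pz, of f] that p_ge_2 by (simp add: Suc_diff_Suc numeral_2_eq_2)
  ultimately have L: "?L ^ (p - 2) * ?z \<in> I" by (intro linear_power_I)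
  have "psum k A - of_nat k \<in> J (Suc 0)"
  proof -
    have "psum k A - of_nat k = (\<Sum>i<k. A ^ i * B ^ 0 - 1)" by (simp add: psum_def sum_subtractf)
    then show ?thesis by (simp only:) (intro Jpow_sum monomial_J)
  qed
  then have "of_nat \<delta> * (B * (psum k A - of_nat k) + of_nat k * y) \<in> J (Suc 0)"
    by (intro Jpow_add Jpow_mult_left Jpow_1)
  then have "?L ^ (p - 2) * (of_nat \<delta> * (B * (psum k A - of_nat k) + of_nat k * y)) \<in> J (p - 2 + Suc 0)"
    by (intro Jpow_mult Jpow_power linear_J)
  then have "?L ^ (p - 2) * (of_nat \<delta> * (B * (psum k A - of_nat k) + of_nat k * y)) * psum p B \<in> I"
    using J_power_I[OF p_psum_I(2)] p_ge_2 by (simp add: Suc_diff_Suc numeral_2_eq_2)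
  from add_I[OF L this] show ?thesis by (simp add: algebra_simps)
qed

text \<open>The coefficient of \<open>k^j\<close> in \<open>rel_linear\<close>. The second summand
  carries an extra factor \<open>k\<close>, so its index is shifted by one; the case distinctions
  handle the two ends \<open>j = p - 1\<close> and \<open>j = 0\<close>.\<close>

definition rel_coeff where
  "rel_coeff j = (if j \<le> p - 2 then of_nat ((p - 2) choose j) * (x ^ j * y ^ (p - 2 - j)) * psum p A else 0)
    - (if j = 0 then 0 else of_nat ((p - 2) choose (j - 1)) * (x ^ (j - 1) * y ^ (p - 2 - (j - 1))) * (of_nat \<delta> * psum p B))"

lemma rel_coeff_I:
  assumes "j < p" shows "rel_coeff j \<in> I"
proof (rule vandermonde[OF p _ _ assms])
  show "of_nat p * rel_coeff i \<in> I" for i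
  proof -
    have "of_nat p * (f * psum p A) \<in> I" "of_nat p * (f * (of_nat \<delta> * psum p B)) \<in> I" for f
      using mult_I[OF p_psum_I(1), of f] mult_I[OF p_psum_I(2), of "f * of_nat \<delta>"] by (simp_all add: mult_ac)
    then show ?thesis unfolding rel_coeff_def right_diff_distrib
      by (intro diff_I) (auto simp: zero_I)
  qed
  fix k
  let ?a = "\<lambda>j. of_nat ((p - 2) choose j) * (x ^ j * y ^ (p - 2 - j))"
  have pp: "p = Suc (Suc (p - 2))" "p - 1 = Suc (p - 2)" using p_ge_2 by auto
  have exp: "(of_nat k * x + of_nat 1 * y) ^ (p - 2) = (\<Sum>j<Suc (p - 2). of_nat k ^ j * ?a j)"
    unfolding linear_power_expand lessThan_Suc_atMost by (simp add: mult_ac)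
  have 1: "(\<Sum>j<p. of_nat k ^ j * (if j \<le> p - 2 then ?a j * psum p A else 0))
      = (\<Sum>j<Suc (p - 2). of_nat k ^ j * ?a j) * psum p A"
  proof -
    have "(\<Sum>j<p. of_nat k ^ j * (if j \<le> p - 2 then ?a j * psum p A else 0))
      = (\<Sum>j<Suc (Suc (p - 2)). of_nat k ^ j * (if j \<le> p - 2 then ?a j * psum p A else 0))"
      using pp(1) by simp
    also have "\<dots> = (\<Sum>j<Suc (p - 2). of_nat k ^ j * (if j \<le> p - 2 then ?a j * psum p A else 0))"
      by (subst sum.lessThan_Suc) simp
    also have "\<dots> = (\<Sum>j<Suc (p - 2). of_nat k ^ j * ?a j * psum p A)"
      by (intro sum.cong) (auto simp: mult_ac)
    finally show ?thesis by (simp only: sum_distrib_right)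
  qed
  have 2: "(\<Sum>j<p. of_nat k ^ j * (if j = 0 then 0 else ?a (j - 1) * (of_nat \<delta> * psum p B)))
      = (\<Sum>j<Suc (p - 2). of_nat k ^ j * ?a j) * (of_nat k * (of_nat \<delta> * psum p B))"
  proof -
    have "(\<Sum>j<p. of_nat k ^ j * (if j = 0 then 0 else ?a (j - 1) * (of_nat \<delta> * psum p B)))
      = (\<Sum>j<Suc (Suc (p - 2)). of_nat k ^ j * (if j = 0 then 0 else ?a (j - 1) * (of_nat \<delta> * psum p B)))"
      using pp(1) by simp
    also have "\<dots> = (\<Sum>j<Suc (p - 2). of_nat k ^ Suc j * (?a j * (of_nat \<delta> * psum p B)))"
      by (subst sum.lessThan_Suc_shift) simp
    also have "\<dots> = (\<Sum>j<Suc (p - 2). of_nat k ^ j * ?a j * (of_nat k * (of_nat \<delta> * psum p B)))"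
      by (intro sum.cong) (auto simp: mult_ac)
    finally show ?thesis by (simp only: sum_distrib_right)
  qed
  show "(\<Sum>i<p. of_nat k ^ i * rel_coeff i) \<in> I"
    using rel_linear[of k] unfolding rel_coeff_def right_diff_distrib[of "of_nat k ^ _"] sum_subtractf 1 2 exp
    by (simp only: right_diff_distrib)
qed

text \<open>The coefficient of \<open>k\<^sup>j\<close> in \<open>rel_linear\<close> is \<open>m (\<alpha> (A\<^sup>p - 1) + \<beta> (B\<^sup>p - 1))\<close> up to \<open>I\<close>, which is
  \<open>m (G\<^sup>p - 1) = psum p G * (G - 1) m\<close> for \<open>G = A\<^sup>\<alpha> B\<^sup>\<beta>\<close>; now \<open>psum_I\<close> applies.\<close>

lemma p_monomial_step_I:
  assumes "j \<ge> 1" "j \<le> p - 2"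
  defines "m \<equiv> x ^ (j - 1) * y ^ (p - 2 - j)"
  shows "of_nat p * (m * (of_nat ((p - 2) choose j) * x
           + of_nat (\<delta> * (p - 1) * ((p - 2) choose (j - 1))) * y)) \<in> I"
proof -
  define \<alpha> where "\<alpha> = (p - 2) choose j"
  define \<gamma> where "\<gamma> = \<delta> * ((p - 2) choose (j - 1))"
  \<comment> \<open>A nonnegative representative of \<open>-\<gamma>\<close> modulo
    \<open>p\<close>, since it has to serve as an exponent of \<open>B\<close>.\<close>
  define \<beta> where "\<beta> = (p - 1) * \<gamma>"
  define P where "P = A ^ p - 1"
  define Q where "Q = B ^ p - 1"
  have P: "P = x * psum p A" and Q: "Q = y * psum p B" by (simp_all add: P_def Q_def psum_mult_diff)
  have cj: "rel_coeff j = m * (of_nat \<alpha> * P) - m * (of_nat \<gamma> * Q)"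
  proof -
    have "x ^ j = x * x ^ (j - 1)" using assms(1) by (cases j) auto
    moreover have "y ^ (p - 2 - (j - 1)) = y * y ^ (p - 2 - j)"
      using assms(1,2) by (metis Suc_diff_diff diff_Suc_1 Suc_diff_le Suc_le_D power_Suc One_nat_def diff_Suc_Suc)
    ultimately show ?thesis using assms(1,2)
      by (simp add: rel_coeff_def m_def P Q \<alpha>_def \<gamma>_def mult_ac)
  qed
  have PP: "P * P \<in> I" "P * Q \<in> I" "Q * P \<in> I" "Q * Q \<in> I"
  proof -
    have "psum p A * psum p A \<in> I" "psum p A * psum p B \<in> I" "psum p B * psum p B \<in> I"
      using p_psum_I psum_A_I psum_B_I by auto
    from mult_I[OF this(1), of "x * x"] mult_I[OF this(2), of "x * y"] mult_I[OF this(3), of "y * y"]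
    show "P * P \<in> I" "P * Q \<in> I" "Q * P \<in> I" "Q * Q \<in> I" by (simp_all add: P Q mult_ac)
  qed
  \<comment> \<open>Since products of two elements among \<open>P\<close>, \<open>Q\<close> lie in
    \<open>I\<close>, the monomial \<open>(1 + P)^\<alpha> (1 + Q)^\<beta>\<close> is linear in
    \<open>P\<close> and \<open>Q\<close> modulo \<open>I\<close>.\<close>
  have J2: "f \<in> I" if "f \<in> Jpow P Q 2" for f
  proof -
    from that obtain f1 f2 where f: "f = P * f1 + Q * f2" "f1 \<in> Jpow P Q (Suc 0)" "f2 \<in> Jpow P Q (Suc 0)"
      unfolding numeral_2_eq_2 by (rule Jpow_SucE)
    have "P * g \<in> I \<and> Q * g \<in> I" if "g \<in> Jpow P Q (Suc 0)" for g
    proof -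
      from that obtain g1 g2 where "g = P * g1 + Q * g2" by (rule Jpow_SucE)
      then show ?thesis
        using add_I[OF mult_I[OF PP(1), of g1] mult_I[OF PP(2), of g2]]
          add_I[OF mult_I[OF PP(3), of g1] mult_I[OF PP(4), of g2]] by (simp add: algebra_simps)
    qed
    with f show ?thesis by (auto intro: add_I)
  qed
  let ?G = "A ^ \<alpha> * B ^ \<beta>"
  have "(1 + P) ^ \<alpha> * (1 + Q) ^ \<beta> - 1 - (of_nat \<alpha> * P + of_nat \<beta> * Q) \<in> I"
    by (intro J2 monomial_linear)
  then have Gp: "?G ^ p - 1 - (of_nat \<alpha> * P + of_nat \<beta> * Q) \<in> I"
    by (simp add: P_def Q_def power_mult_distrib power_mult[symmetric] mult.commute)
  have "of_nat \<beta> + of_nat \<gamma> = (of_nat p * of_nat \<gamma> :: 'r)"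
    using p_ge_2 by (simp add: \<beta>_def of_nat_diff algebra_simps)
  moreover have "m * (of_nat \<alpha> * P + of_nat \<beta> * Q) - rel_coeff j = m * Q * (of_nat \<beta> + of_nat \<gamma>)"
    unfolding cj by (simp only: algebra_simps)
  ultimately have "m * (of_nat \<alpha> * P + of_nat \<beta> * Q) - rel_coeff j = m * y * of_nat \<gamma> * (of_nat p * psum p B)"
    by (simp only: Q mult_ac)
  moreover have "rel_coeff j \<in> I" using assms(2) p_ge_2 by (intro rel_coeff_I) simp
  ultimately have "m * (of_nat \<alpha> * P + of_nat \<beta> * Q) \<in> I"
    using mult_I[OF p_psum_I(2), of "m * y * of_nat \<gamma>"] cong_I by metis
  with mult_I[OF Gp, of m] have "m * (?G ^ p - 1) \<in> I"
    using add_I[of "m * (?G ^ p - 1 - (of_nat \<alpha> * P + of_nat \<beta> * Q))" "m * (of_nat \<alpha> * P + of_nat \<beta> * Q)"]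
    by (simp add: algebra_simps)
  then have "psum p ?G * ((?G - 1) * m) \<in> I"
    unfolding psum_mult_diff[of ?G p, symmetric] by (simp add: mult_ac)
  then have 1: "of_nat p * ((?G - 1) * m) \<in> I" using psum_I by blast
  \<comment> \<open>The degree of \<open>m\<close> is \<open>p - 3\<close>, so the quadratic error
    in replacing \<open>G - 1\<close> by its linear form has total degree exactly
    \<open>p - 1\<close>.\<close>
  have e: "2 + ((j - 1) + (p - 2 - j)) = p - 1" using assms(1,2) by simp
  have "m \<in> J ((j - 1) + (p - 2 - j))" unfolding m_def by (rule Jpow_monomial)
  then have "(?G - 1 - (of_nat \<alpha> * x + of_nat \<beta> * y)) * m \<in> J (2 + ((j - 1) + (p - 2 - j)))"
    by (intro Jpow_mult monomial_linear_J)
  then have "(?G - 1 - (of_nat \<alpha> * x + of_nat \<beta> * y)) * m * of_nat p \<in> I"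
    by (intro J_power_I[OF p2]) (simp only: e)
  from diff_I[OF 1 this] show ?thesis
    by (simp add: \<alpha>_def \<beta>_def \<gamma>_def algebra_simps)
qed

text \<open>A walk from \<open>y^(p-2)\<close> to \<open>x^(p-2)\<close>. The coefficient at
  \<open>j = 0\<close> gives the start. Each step trades one \<open>y\<close> for one
  \<open>x\<close>, because \<open>(p - 2) choose Suc j\<close> is prime to
  \<open>p\<close>.\<close>

lemma p_monomial_I: "j \<le> p - 2 \<Longrightarrow> of_nat p * (x ^ j * y ^ (p - 2 - j)) \<in> I"
proof (induction j)
  case 0
  have "rel_coeff 0 \<in> I" using rel_coeff_I p_ge_2 by simp
  then have "psum p A * y ^ (p - 2) \<in> I" by (simp add: rel_coeff_def mult_ac)
  then show ?case using psum_A_I by simp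
next
  case (Suc j)
  define \<alpha> where "\<alpha> = (p - 2) choose Suc j"
  define \<beta> where "\<beta> = \<delta> * (p - 1) * ((p - 2) choose j)"
  let ?h = "\<lambda>j. x ^ j * y ^ (p - 2 - j)"
  have h: "of_nat p * ?h j \<in> I" using Suc by simp
  have "y ^ (p - 2 - j) = y * y ^ (p - 2 - Suc j)"
    using Suc.prems by (metis Suc_diff_Suc Suc_le_lessD power_Suc)
  then have "of_nat p * (x ^ j * y ^ (p - 2 - Suc j) * (of_nat \<alpha> * x + of_nat \<beta> * y))
      = of_nat \<alpha> * (of_nat p * ?h (Suc j)) + of_nat \<beta> * (of_nat p * ?h j)"
    by (simp only: power_Suc distrib_left mult_ac)
  then have "of_nat \<alpha> * (of_nat p * ?h (Suc j)) + of_nat \<beta> * (of_nat p * ?h j) \<in> I"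
    using p_monomial_step_I[of "Suc j"] Suc.prems by (simp add: \<alpha>_def \<beta>_def)
  from diff_I[OF this mult_I[OF h, of "of_nat \<beta>"]] have "of_nat \<alpha> * (of_nat p * ?h (Suc j)) \<in> I"
    by simp
  moreover have "of_nat p * (of_nat p * ?h (Suc j)) \<in> I"
    using mult_I'[OF p2, of "?h (Suc j)"] by (simp add: mult.assoc)
  ultimately show ?case
    using coprime_cancel_I[OF coprime_choose[of "p - 2" "Suc j"], of "of_nat p * ?h (Suc j)"] Suc.prems p_ge_2
    by (simp add: \<alpha>_def)
qed

lemma p_J_I: "f \<in> J (p - 2) \<Longrightarrow> of_nat p * f \<in> I"
  using Jpow_mult_I[of "p - 2" x y "of_nat p" f] p_monomial_I by (simp add: mult.commute)

end

section \<open>The exponent of the error term in the power formula\<close>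

lemma psum_psum_cancel:
  fixes A B :: "'r::idom"
  assumes "A \<noteq> 1"
  shows "(\<Sum>i<n. B ^ i * psum i A)
    = (\<Sum>r<n. of_nat (n choose Suc r) * (B * (\<Sum>i<r. (A * B - 1) ^ i * (B - 1) ^ (r - Suc i))))"
proof -
  \<comment> \<open>Multiplication by \<open>A - 1\<close> turns the double sum into a difference of
    two norms. Their binomial expansions differ termwise by multiples of
    \<open>(A * B - 1) - (B - 1) = (A - 1) * B\<close>, so \<open>A - 1\<close> can be cancelled
    again.\<close>
  have "(A - 1) * (\<Sum>i<n. B ^ i * psum i A) = psum n (A * B) - psum n B"
    unfolding sum_distrib_left psum_def[of n] sum_subtractf[symmetric]
  proof (rule sum.cong)
    show "(A - 1) * (B ^ i * psum i A) = (A * B) ^ i - B ^ i" for i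
    proof -
      have "(A - 1) * (B ^ i * psum i A) = B ^ i * ((A - 1) * psum i A)" by (simp only: mult_ac)
      then show ?thesis by (simp only: psum_mult_diff) (simp add: algebra_simps power_mult_distrib)
    qed
  qed simp
  also have "\<dots> = (\<Sum>r<n. of_nat (n choose Suc r) * ((A * B - 1) ^ r - (B - 1) ^ r))"
    using psum_binomial[of n "A * B - 1"] psum_binomial[of n "B - 1"]
    by (simp add: sum_subtractf right_diff_distrib)
  also have "\<dots> = (\<Sum>r<n. of_nat (n choose Suc r) * ((A - 1) * (B * (\<Sum>i<r. (A * B - 1) ^ i * (B - 1) ^ (r - Suc i)))))"
  proof (rule sum.cong)
    fix r
    have factor: "A * B - 1 - (B - 1) = (A - 1) * B" by (simp add: algebra_simps)
    have "(A * B - 1) ^ r - (B - 1) ^ r = ((A * B - 1) - (B - 1)) * (\<Sum>i<r. (B - 1) ^ (r - Suc i) * (A * B - 1) ^ i)"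
      by (rule power_diff_sumr2)
    then show "of_nat (n choose Suc r) * ((A * B - 1) ^ r - (B - 1) ^ r)
      = of_nat (n choose Suc r) * ((A - 1) * (B * (\<Sum>i<r. (A * B - 1) ^ i * (B - 1) ^ (r - Suc i))))"
      by (simp add: factor mult_ac)
  qed simp
  also have "\<dots> = (A - 1) * (\<Sum>r<n. of_nat (n choose Suc r) * (B * (\<Sum>i<r. (A * B - 1) ^ i * (B - 1) ^ (r - Suc i))))"
    unfolding sum_distrib_left[of "A - 1"] by (intro sum.cong) (simp_all only: mult_ac)
  finally show ?thesis using assms by simp
qed

lemma (in power_ideal) p_commutator_sum_I:
  assumes "\<exists>E \<in> J (p - 2). \<exists>U. e = E + of_nat p * U"
  shows "of_nat p * e \<in> I"
proof -
  from assms obtain E U where E: "E \<in> J (p - 2)" "e = E + of_nat p * U" by blast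
  then show ?thesis using add_I[OF p_J_I[OF E(1)] mult_I[OF p2, of U]]
    by (simp add: algebra_simps)
qed

text \<open>Modulo \<open>p\<close> only the summand \<open>r = p - 1\<close> survives, and it is
  \<open>B\<close> times a sum of products of \<open>p - 2\<close> factors \<open>A * B - 1\<close>
  or \<open>B - 1\<close>, all lying in the ideal.\<close>

lemma commutator_sum_decomp:
  fixes A B :: "'r::idom"
  assumes p: "Factorial_Ring.prime p" and "A \<noteq> 1"
  shows "\<exists>E \<in> Jpow (A - 1) (B - 1) (p - 2). \<exists>U. (\<Sum>i<p. B ^ i * psum i A) = E + of_nat p * U"
proof -
  define f where "f r = B * (\<Sum>i<r. (A * B - 1) ^ i * (B - 1) ^ (r - Suc i))" for r
  have pp: "Suc (p - 1) = p" "p - 2 = p - 1 - Suc 0" using p by (auto simp: prime_gt_0_nat)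
  obtain U where U: "(\<Sum>r<Suc (p - 1). of_nat (p choose Suc r) * f r) = f (p - 1) + of_nat p * U"
    by (rule sum_multiple_plus_last[where m="p - 1" and p=p and c="\<lambda>r. p choose Suc r" and f=f])
      (use p pp in \<open>auto intro!: dvd_choose_prime\<close>)
  have "(\<Sum>i<p - 1. (A * B - 1) ^ i * (B - 1) ^ (p - 1 - Suc i)) \<in> Jpow (A - 1) (B - 1) (p - 2)"
  proof (rule Jpow_sum)
    fix i assume i: "i \<in> {..<p - 1}"
    have "A * B - 1 = B * (A - 1) + (B - 1)" by (simp add: algebra_simps)
    then have "A * B - 1 \<in> Jpow (A - 1) (B - 1) (Suc 0)"
      by (simp only:) (intro Jpow_add Jpow_mult_left Jpow_1)
    then have "(A * B - 1) ^ i * (B - 1) ^ (p - 1 - Suc i) \<in> Jpow (A - 1) (B - 1) (i + (p - 1 - Suc i))"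
      by (intro Jpow_mult Jpow_power Jpow_1)
    moreover have "i + (p - 1 - Suc i) = p - 2" using i by auto
    ultimately show "(A * B - 1) ^ i * (B - 1) ^ (p - 1 - Suc i) \<in> Jpow (A - 1) (B - 1) (p - 2)" by simp
  qed
  then have "f (p - 1) \<in> Jpow (A - 1) (B - 1) (p - 2)"
    unfolding f_def by (rule Jpow_mult_left)
  moreover have "(\<Sum>i<p. B ^ i * psum i A) = f (p - 1) + of_nat p * U"
    using U psum_psum_cancel[OF assms(2), where n=p and B=B] unfolding pp(1) f_def by simp
  ultimately show ?thesis by blast
qed

section \<open>Additive maps from a ring into a group\<close>

locale ring_to_group = group G for G (structure) +
  fixes \<phi> :: "'r::comm_ring_1 \<Rightarrow> 'a"
  assumes phi_closed [simp]: "\<phi> f \<in> carrier G"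
    and phi_add: "\<phi> (f + g) = \<phi> f \<otimes> \<phi> g"
begin

text \<open>Conjugation by \<open>g\<close> is multiplication by \<open>\<Gamma>\<close> on the
  image of \<open>\<phi>\<close>, written without inverses so that factors can be moved directly
  through products.\<close>

definition acts :: "'a \<Rightarrow> 'r \<Rightarrow> bool" where
  "acts g \<Gamma> \<longleftrightarrow> g \<in> carrier G \<and> (\<forall>f. \<phi> f \<otimes> g = g \<otimes> \<phi> (\<Gamma> * f))"

lemma phi_0 [simp]: "\<phi> 0 = \<one>"
  using phi_add[of 0 0] by (metis add.left_neutral l_cancel_one phi_closed)

lemma phi_uminus: "\<phi> (- f) = inv (\<phi> f)"
  using phi_add[of "- f" f] by (metis add.left_inverse inv_equality phi_0 phi_closed)

lemma phi_of_nat: "\<phi> (of_nat n * f) = \<phi> f [^] n"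
proof (induction n)
  case (Suc n)
  have "of_nat (Suc n) * f = of_nat n * f + f" by (simp add: algebra_simps)
  then show ?case using Suc by (simp add: phi_add nat_pow_Suc)
qed simp

lemma actsD: "acts g \<Gamma> \<Longrightarrow> g \<in> carrier G" "acts g \<Gamma> \<Longrightarrow> \<phi> f \<otimes> g = g \<otimes> \<phi> (\<Gamma> * f)"
  by (auto simp: acts_def)

lemma acts_mult:
  assumes "acts g \<Gamma>" "acts h \<Delta>" shows "acts (g \<otimes> h) (\<Gamma> * \<Delta>)"
  unfolding acts_def
proof (intro conjI allI)
  show "g \<otimes> h \<in> carrier G" using assms by (simp add: actsD)
  fix f
  have "\<phi> f \<otimes> (g \<otimes> h) = (\<phi> f \<otimes> g) \<otimes> h" using assms by (simp add: actsD(1) m_assoc)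
  also have "\<dots> = g \<otimes> (\<phi> (\<Gamma> * f) \<otimes> h)"
    using assms actsD(1) by (simp add: actsD(2)[OF assms(1)] m_assoc)
  also have "\<dots> = g \<otimes> h \<otimes> \<phi> (\<Gamma> * \<Delta> * f)"
    using assms actsD(1) by (simp add: actsD(2)[OF assms(2)] m_assoc mult_ac)
  finally show "\<phi> f \<otimes> (g \<otimes> h) = g \<otimes> h \<otimes> \<phi> (\<Gamma> * \<Delta> * f)" .
qed

lemma acts_pow: "acts g \<Gamma> \<Longrightarrow> acts (g [^] (n::nat)) (\<Gamma> ^ n)"
proof (induction n)
  case 0
  then show ?case by (simp add: acts_def)
next
  case (Suc n)
  then show ?case using acts_mult[OF Suc.IH[OF Suc.prems] Suc.prems] by (simp add: mult.commute)
qed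

text \<open>The origin of the norms: the copies of \<open>\<phi> f\<close> are collected on the
  right, each passing a different number of factors \<open>g\<close>.\<close>

lemma mult_phi_pow:
  assumes "acts g \<Gamma>"
  shows "(g \<otimes> \<phi> f) [^] (n::nat) = g [^] n \<otimes> \<phi> (psum n \<Gamma> * f)"
proof (induction n)
  case (Suc n)
  have g: "g \<in> carrier G" using assms by (simp add: actsD)
  have e: "\<Gamma> * (psum n \<Gamma> * f) + f = psum (Suc n) \<Gamma> * f"
  proof -
    have "\<Gamma> * psum n \<Gamma> + 1 = psum (Suc n) \<Gamma>"
      using psum_mult_diff[of \<Gamma> n] by (simp add: psum_Suc algebra_simps)
    then show ?thesis by (metis distrib_right mult.assoc mult_1)
  qed
  have "(g \<otimes> \<phi> f) [^] Suc n = g [^] n \<otimes> (\<phi> (psum n \<Gamma> * f) \<otimes> g) \<otimes> \<phi> f"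
    using Suc g by (simp add: nat_pow_Suc m_assoc)
  also have "\<dots> = g [^] n \<otimes> g \<otimes> \<phi> (\<Gamma> * (psum n \<Gamma> * f) + f)"
    using g by (simp add: actsD(2)[OF assms] phi_add m_assoc)
  finally show ?case unfolding e by (simp add: nat_pow_Suc)
qed simp

lemma commute_pow:
  assumes "acts g \<Gamma>" "v \<in> carrier G" "v \<otimes> g = g \<otimes> v \<otimes> \<phi> s"
  shows "v \<otimes> g [^] (n::nat) = g [^] n \<otimes> v \<otimes> \<phi> (s * psum n \<Gamma>)"
proof (induction n)
  case (Suc n)
  have g: "g \<in> carrier G" using assms by (simp add: actsD)
  have e: "s + \<Gamma> * (s * psum n \<Gamma>) = s * psum (Suc n) \<Gamma>"
  proof -
    have "1 + \<Gamma> * psum n \<Gamma> = psum (Suc n) \<Gamma>"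
      using psum_mult_diff[of \<Gamma> n] by (simp add: psum_Suc algebra_simps)
    then show ?thesis by (metis distrib_left mult.left_commute mult_1_right)
  qed
  have "v \<otimes> g [^] Suc n = (v \<otimes> g [^] n) \<otimes> g" using g assms by (simp add: nat_pow_Suc m_assoc)
  also have "\<dots> = g [^] n \<otimes> v \<otimes> (\<phi> (s * psum n \<Gamma>) \<otimes> g)"
    unfolding Suc using g assms by (simp add: m_assoc)
  also have "\<dots> = g [^] n \<otimes> (v \<otimes> g) \<otimes> \<phi> (\<Gamma> * (s * psum n \<Gamma>))"
    using g assms(2) by (simp add: actsD(2)[OF assms(1)] m_assoc)
  also have "\<dots> = g [^] n \<otimes> g \<otimes> v \<otimes> \<phi> (s + \<Gamma> * (s * psum n \<Gamma>))"
    unfolding assms(3) using g assms(2) by (simp add: phi_add m_assoc)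
  finally show ?case unfolding e by (simp add: nat_pow_Suc)
qed (use assms in simp)

text \<open>The metabelian collection formula. \<open>comm\<close> speaks only of multiples of
  \<open>s\<close> because one application takes \<open>v = z\<close>, where commutation is
  established only for elements killed by \<open>p\<close>; the other takes
  \<open>v = b\<close>.\<close>

lemma mult_pow:
  assumes "acts g \<Gamma>" "v \<in> carrier G" "v \<otimes> g = g \<otimes> v \<otimes> \<phi> s"
    and comm: "\<And>f. \<phi> (s * f) \<otimes> v = v \<otimes> \<phi> (V * (s * f))"
  shows "(g \<otimes> v) [^] (n::nat) = g [^] n \<otimes> v [^] n \<otimes> \<phi> (s * (\<Sum>i<n. V ^ i * psum i \<Gamma>))"
proof (induction n)
  case (Suc n)
  have g: "g \<in> carrier G" using assms by (simp add: actsD)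
  have comm_pow: "\<phi> (s * f) \<otimes> v [^] m = v [^] m \<otimes> \<phi> (s * (V ^ m * f))" for f and m :: nat
  proof (induction m)
    case (Suc m)
    have "\<phi> (s * f) \<otimes> v [^] Suc m = (\<phi> (s * f) \<otimes> v [^] m) \<otimes> v"
      using assms(2) by (simp add: nat_pow_Suc m_assoc)
    also have "\<dots> = v [^] m \<otimes> (\<phi> (s * (V ^ m * f)) \<otimes> v)"
      unfolding Suc using assms(2) by (simp add: m_assoc)
    also have "\<dots> = v [^] m \<otimes> v \<otimes> \<phi> (s * (V ^ Suc m * f))"
      unfolding comm using assms(2) by (simp add: m_assoc mult_ac)
    finally show ?case by (simp add: nat_pow_Suc)
  qed (use assms in simp)
  let ?E = "\<Sum>i<n. V ^ i * psum i \<Gamma>"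
  have "(g \<otimes> v) [^] Suc n = g \<otimes> v \<otimes> (g \<otimes> v) [^] n"
    using g assms(2) by (metis m_closed nat_pow_Suc2)
  also have "\<dots> = g \<otimes> (v \<otimes> g [^] n) \<otimes> v [^] n \<otimes> \<phi> (s * ?E)"
    unfolding Suc using g assms(2) by (simp add: m_assoc)
  also have "\<dots> = g \<otimes> g [^] n \<otimes> v \<otimes> (\<phi> (s * psum n \<Gamma>) \<otimes> v [^] n) \<otimes> \<phi> (s * ?E)"
    unfolding commute_pow[OF assms(1-3)] using g assms(2) by (simp add: m_assoc)
  also have "\<dots> = (g \<otimes> g [^] n) \<otimes> (v \<otimes> v [^] n) \<otimes> \<phi> (s * (V ^ n * psum n \<Gamma>) + s * ?E)"
    unfolding comm_pow using g assms(2) by (simp add: phi_add m_assoc)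
  also have "\<dots> = g [^] Suc n \<otimes> v [^] Suc n \<otimes> \<phi> (s * (\<Sum>i<Suc n. V ^ i * psum i \<Gamma>))"
    using g assms(2) nat_pow_Suc2 by (metis (no_types, lifting) add.commute distrib_left sum.lessThan_Suc)
  finally show ?case .
qed simp

end

section \<open>Conjugation and the construction of the module map\<close>

context group
begin

lemma intertwine_pow:
  assumes "g \<in> carrier G" "x \<in> carrier G" "y \<in> carrier G" "x \<otimes> g = g \<otimes> y"
  shows "x [^] (n::nat) \<otimes> g = g \<otimes> y [^] n"
proof (induction n)
  case (Suc n)
  have "x [^] Suc n \<otimes> g = x [^] n \<otimes> (x \<otimes> g)" using assms(1-3) by (simp add: m_assoc)
  also have "\<dots> = (x [^] n \<otimes> g) \<otimes> y" unfolding assms(4) using assms(1-3) by (simp add: m_assoc)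
  also have "\<dots> = g \<otimes> y [^] Suc n" unfolding Suc using assms(1-3) by (simp add: m_assoc)
  finally show ?case .
qed (use assms in simp)

lemma mult_inv_mult [simp]:
  "x \<in> carrier G \<Longrightarrow> u \<in> carrier G \<Longrightarrow> x \<otimes> (inv x \<otimes> u) = u"
  by (simp add: m_assoc[symmetric])

lemma conj_mult:
  assumes "g \<in> carrier G" "u \<in> carrier G" "v \<in> carrier G"
  shows "inv g \<otimes> (u \<otimes> v) \<otimes> g = (inv g \<otimes> u \<otimes> g) \<otimes> (inv g \<otimes> v \<otimes> g)"
  using assms by (simp add: m_assoc)

text \<open>An additive map on coefficients is extended so that multiplication by the variable
  becomes conjugation by \<open>g\<close>. The last clause carries an action already present on the
  coefficients through the extension; it preserves the action of \<open>a\<close> when the second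
  variable is adjoined.\<close>

lemma horner_extension:
  fixes \<psi> :: "'c::comm_ring_1 \<Rightarrow> 'a"
  assumes sub: "subgroup A G" and comm: "\<And>u v. u \<in> A \<Longrightarrow> v \<in> A \<Longrightarrow> u \<otimes> v = v \<otimes> u"
    and conj: "\<And>u h. u \<in> A \<Longrightarrow> h \<in> carrier G \<Longrightarrow> inv h \<otimes> u \<otimes> h \<in> A"
    and psi: "\<And>c. \<psi> c \<in> A" "\<And>c d. \<psi> (c + d) = \<psi> c \<otimes> \<psi> d" and g: "g \<in> carrier G"
  obtains H :: "'c poly \<Rightarrow> 'a" where "\<And>f. H f \<in> A" "\<And>f f'. H (f + f') = H f \<otimes> H f'"
    "\<And>c. H [:c:] = \<psi> c" "\<And>f. inv g \<otimes> H f \<otimes> g = H (pCons 0 f)"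
    "\<And>h \<Gamma> f. h \<in> carrier G \<Longrightarrow> (\<And>c. inv h \<otimes> \<psi> c \<otimes> h = \<psi> (\<Gamma> * c)) \<Longrightarrow>
       (\<And>u. u \<in> A \<Longrightarrow> inv h \<otimes> (inv g \<otimes> u \<otimes> g) \<otimes> h = inv g \<otimes> (inv h \<otimes> u \<otimes> h) \<otimes> g) \<Longrightarrow>
       inv h \<otimes> H f \<otimes> h = H (Polynomial.smult \<Gamma> f)"
proof -
  define H where "H f = fold_coeffs (\<lambda>c s. \<psi> c \<otimes> (inv g \<otimes> s \<otimes> g)) f \<one>" for f
  have AG: "u \<in> carrier G" if "u \<in> A" for u using sub that by (rule subgroup.mem_carrier)
  have psi0: "\<psi> 0 = \<one>"
    using psi(2)[of 0 0] psi(1)[of 0] AG by (metis add_0 l_cancel_one)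
  have H0: "H 0 = \<one>" by (simp add: H_def)
  \<comment> \<open>The zero polynomial has no coefficients to fold over, so this recursion at
    \<open>pCons 0 0\<close> rests on \<open>\<psi> 0\<close> being trivial.\<close>
  have H_pCons: "H (pCons c f) = \<psi> c \<otimes> (inv g \<otimes> H f \<otimes> g)" for c f
    using g psi0 by (cases "f = 0"; cases "c = 0") (simp_all add: H_def)
  have HA: "H f \<in> A" for f
  proof (induction f)
    case 0
    then show ?case using sub by (simp add: H0 subgroup.one_closed)
  next
    case (pCons c f)
    then show ?case using subgroup.m_closed[OF sub psi(1) conj[OF _ g]] by (simp add: H_pCons)
  qed
  have H_add: "H (f + f') = H f \<otimes> H f'" for f f'
  proof (induction f f' rule: poly_induct2)
    case 0
    then show ?case by (simp add: H0)
  next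
    case (pCons c f d f')
    let ?k = "\<lambda>u. inv g \<otimes> u \<otimes> g"
    have "H (pCons c f + pCons d f') = \<psi> c \<otimes> \<psi> d \<otimes> (?k (H f) \<otimes> ?k (H f'))"
      using pCons HA AG g by (simp add: H_pCons psi conj_mult)
    also have "\<dots> = \<psi> c \<otimes> (\<psi> d \<otimes> ?k (H f)) \<otimes> ?k (H f')"
      using psi HA AG g by (simp add: m_assoc)
    also have "\<psi> d \<otimes> ?k (H f) = ?k (H f) \<otimes> \<psi> d"
      by (intro comm psi conj HA g)
    finally show ?case using psi HA AG g by (simp add: H_pCons m_assoc)
  qed
  have "inv h \<otimes> H f \<otimes> h = H (Polynomial.smult \<Gamma> f)"
    if h: "h \<in> carrier G" and hpsi: "\<And>c. inv h \<otimes> \<psi> c \<otimes> h = \<psi> (\<Gamma> * c)"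
      and gh: "\<And>u. u \<in> A \<Longrightarrow> inv h \<otimes> (inv g \<otimes> u \<otimes> g) \<otimes> h = inv g \<otimes> (inv h \<otimes> u \<otimes> h) \<otimes> g" for h \<Gamma> f
  proof (induction f)
    case 0
    then show ?case using h by (simp add: H0)
  next
    case (pCons c f)
    have "inv h \<otimes> H (pCons c f) \<otimes> h = \<psi> (\<Gamma> * c) \<otimes> (inv h \<otimes> (inv g \<otimes> H f \<otimes> g) \<otimes> h)"
      unfolding H_pCons hpsi[symmetric] using AG[OF psi(1)] AG[OF HA] g h by (intro conj_mult) auto
    also have "\<dots> = H (Polynomial.smult \<Gamma> (pCons c f))"
      using gh[OF HA] pCons by (simp add: H_pCons)
    finally show ?case .
  qed
  moreover have "H [:c:] = \<psi> c" for c using g AG[OF psi(1)] by (simp add: H_pCons H0)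
  moreover have "inv g \<otimes> H f \<otimes> g = H (pCons 0 f)" for f
    using g AG[OF HA] by (simp add: H_pCons psi0)
  ultimately show thesis using that[of H] HA H_add by blast
qed

text \<open>The module map \<open>f \<mapsto> f w\<close>, built by evaluating polynomials with Horner's scheme, first in
  \<open>a\<close> and then in \<open>b\<close>.\<close>

lemma two_variable_action:
  assumes sub: "subgroup A G" and comm: "\<And>u v. u \<in> A \<Longrightarrow> v \<in> A \<Longrightarrow> u \<otimes> v = v \<otimes> u"
    and conj: "\<And>u h. u \<in> A \<Longrightarrow> h \<in> carrier G \<Longrightarrow> inv h \<otimes> u \<otimes> h \<in> A"
    and ab: "a \<in> carrier G" "b \<in> carrier G" "w \<in> A" "a \<otimes> b = b \<otimes> a \<otimes> w"
  obtains \<phi> :: "int poly poly \<Rightarrow> 'a" where "ring_to_group G \<phi>" "\<phi> 1 = w"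
    "ring_to_group.acts G \<phi> a [:[:0, 1:]:]" "ring_to_group.acts G \<phi> b [:0, 1:]"
proof -
  have AG: "u \<in> carrier G" if "u \<in> A" for u using sub that by (rule subgroup.mem_carrier)
  have w: "w \<in> carrier G" using ab AG by blast
  obtain H :: "int poly \<Rightarrow> 'a" where H: "\<And>f. H f \<in> A" "\<And>f f'. H (f + f') = H f \<otimes> H f'"
    "\<And>c. H [:c:] = w [^] c" "\<And>f. inv a \<otimes> H f \<otimes> a = H (pCons 0 f)"
  proof (rule horner_extension[OF sub comm conj, of "\<lambda>c::int. w [^] c" a])
    show "w [^] c \<in> A" for c :: int using sub ab(3) by (rule subgroup_int_pow_closed)
    show "w [^] (c + d) = w [^] c \<otimes> w [^] d" for c d :: int using w by (rule int_pow_mult)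
  qed (use ab in auto)
  obtain F :: "int poly poly \<Rightarrow> 'a" where F: "\<And>f. F f \<in> A" "\<And>f f'. F (f + f') = F f \<otimes> F f'"
    "\<And>c. F [:c:] = H c" "\<And>f. inv b \<otimes> F f \<otimes> b = F (pCons 0 f)"
    "\<And>h \<Gamma> f. h \<in> carrier G \<Longrightarrow> (\<And>c. inv h \<otimes> H c \<otimes> h = H (\<Gamma> * c)) \<Longrightarrow>
       (\<And>u. u \<in> A \<Longrightarrow> inv h \<otimes> (inv b \<otimes> u \<otimes> b) \<otimes> h = inv b \<otimes> (inv h \<otimes> u \<otimes> h) \<otimes> b) \<Longrightarrow>
       inv h \<otimes> F f \<otimes> h = F (Polynomial.smult \<Gamma> f)"
    by (rule horner_extension[OF sub comm conj, of H b]) (use ab H in auto)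
  \<comment> \<open>Conjugation by \<open>a b\<close> is conjugation by \<open>b a\<close> followed
    by conjugation by \<open>w\<close>, and the latter is trivial on the abelian group
    \<open>A\<close>. This is why a commutative polynomial ring can act.\<close>
  have conj_ab: "inv a \<otimes> (inv b \<otimes> u \<otimes> b) \<otimes> a = inv b \<otimes> (inv a \<otimes> u \<otimes> a) \<otimes> b" if u: "u \<in> A" for u
  proof -
    have ug: "u \<in> carrier G" using AG u .
    let ?v = "inv (b \<otimes> a) \<otimes> u \<otimes> (b \<otimes> a)"
    have v: "?v \<in> A" using conj[OF u, of "b \<otimes> a"] ab by simp
    have "inv b \<otimes> (inv a \<otimes> u \<otimes> a) \<otimes> b = inv (a \<otimes> b) \<otimes> u \<otimes> (a \<otimes> b)"
      using ab(1,2) ug by (simp add: inv_mult_group m_assoc)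
    also have "\<dots> = inv w \<otimes> ?v \<otimes> w"
      unfolding ab(4) using ab(1,2) w ug by (simp add: inv_mult_group m_assoc)
    also have "\<dots> = inv w \<otimes> (w \<otimes> ?v)"
      using comm[OF v ab(3)] w AG[OF v] by (simp add: m_assoc del: inv_mult_group)
    also have "\<dots> = ?v" using w AG[OF v] by (simp add: m_assoc[symmetric])
    finally show ?thesis using ab(1,2) ug by (simp add: inv_mult_group m_assoc)
  qed
  have a: "inv a \<otimes> F f \<otimes> a = F (Polynomial.smult [:0, 1:] f)" for f
    by (rule F(5)) (use ab conj_ab H(4) in auto)
  have move: "u \<otimes> g = g \<otimes> (inv g \<otimes> u \<otimes> g)" if "u \<in> carrier G" "g \<in> carrier G" for u g
    using that by (simp add: m_assoc[symmetric])
  interpret ring_to_group G F by unfold_locales (use F AG in auto)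
  show thesis
  proof (rule that[of F])
    show "F 1 = w" using F(3)[of 1] H(3)[of 1] w by (simp add: one_pCons)
    show "acts a [:[:0, 1:]:]"
      using ab move[of "F _" a] a by (simp add: acts_def)
    show "acts b [:0, 1:]"
      using ab move[of "F _" b] F(4) by (simp add: acts_def)
  qed unfold_locales
qed

end

section \<open>Semi-p-abelian metabelian groups\<close>

context group
begin

lemma semi_pi_abelianD:
  assumes "semi_pi_abelian G p i" "a \<in> carrier G" "b \<in> carrier G"
  shows "(a \<otimes> b) [^] (p ^ i) = \<one> \<longleftrightarrow> a [^] (p ^ i) \<otimes> b [^] (p ^ i) = \<one>"
  using assms by (simp add: semi_pi_abelian_def)

text \<open>The definition is applied to the pair \<open>inv g\<close> and
  \<open>g \<otimes> t\<close>, whose product is \<open>t\<close>.\<close>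

lemma semi_p_mult_right:
  assumes "semi_pi_abelian G p 1" "g \<in> carrier G" "t \<in> carrier G"
  shows "(g \<otimes> t) [^] p = g [^] p \<longleftrightarrow> t [^] p = \<one>"
proof -
  have "inv g \<otimes> (g \<otimes> t) = t" using assms by (simp add: m_assoc[symmetric])
  then have "t [^] p = \<one> \<longleftrightarrow> inv (g [^] p) \<otimes> (g \<otimes> t) [^] p = \<one>"
    using semi_pi_abelianD[OF assms(1), of "inv g" "g \<otimes> t"] assms by (simp add: nat_pow_inv)
  also have "\<dots> \<longleftrightarrow> (g \<otimes> t) [^] p = g [^] p"
    using assms by (metis inv_closed inv_inv inv_unique' l_inv m_closed nat_pow_closed inv_equality)
  finally show ?thesis by simp
qed

lemma semi_p_mult_left:
  assumes "semi_pi_abelian G p 1" "g \<in> carrier G" "t \<in> carrier G" "t [^] p = \<one>"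
  shows "(t \<otimes> g) [^] p = g [^] p"
proof -
  have "(inv g \<otimes> t \<otimes> g) [^] p = \<one>"
    using intertwine_pow[of g t "inv g \<otimes> t \<otimes> g" p] assms
    by (simp add: m_assoc[symmetric] l_cancel_one')
  then have "(g \<otimes> (inv g \<otimes> t \<otimes> g)) [^] p = g [^] p"
    using semi_p_mult_right[OF assms(1)] assms by simp
  then show ?thesis using assms by (simp add: m_assoc[symmetric])
qed

text \<open>The parameter \<open>\<delta>\<close> handles \<open>z = a^p b^p\<close>
  (\<open>\<delta> = 1\<close>) and \<open>z = a^p\<close> (\<open>\<delta> = 0\<close>) by one
  computation.\<close>

lemma pow_p_mult_eq:
  fixes \<delta> :: nat
  assumes p: "Factorial_Ring.prime p"
    and metab: "derived G (derived G (carrier G)) = {\<one>}"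
    and semi: "semi_pi_abelian G p 1"
    and a: "a \<in> carrier G" and b: "b \<in> carrier G" and \<delta>: "\<delta> \<le> 1"
    and z1: "(a [^] p \<otimes> (b [^] p) [^] \<delta>) [^] p = \<one>"
  shows "\<exists>e \<in> carrier G. e [^] p = \<one> \<and> (a \<otimes> b) [^] p = a [^] p \<otimes> b [^] p \<otimes> e"
proof -
  define D where "D = derived G (carrier G)"
  \<comment> \<open>The commutator of \<open>inv a\<close> and \<open>inv b\<close> in the form of
    the generators of \<open>derived\<close>; the double inverses keep that shape.\<close>
  define w where "w = inv a \<otimes> inv b \<otimes> inv (inv a) \<otimes> inv (inv b)"
  have D_sub: "subgroup D G" unfolding D_def by (rule derived_is_subgroup) simp
  have DG: "u \<in> carrier G" if "u \<in> D" for u using subgroup.mem_carrier[OF D_sub that] .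
  have comm: "u \<otimes> v = v \<otimes> u" if "u \<in> D" "v \<in> D" for u v
  proof -
    have "u \<otimes> v \<otimes> inv u \<otimes> inv v \<in> derived G D"
      unfolding derived_def using that by (blast intro: generate.incl)
    then have "u \<otimes> v \<otimes> inv u \<otimes> inv v = \<one>" using metab by (simp add: D_def)
    then have "u \<otimes> v \<otimes> inv (v \<otimes> u) = \<one>" using DG that by (simp add: inv_mult_group m_assoc)
    then show ?thesis using DG that by (metis inv_equality inv_inv m_closed inv_closed)
  qed
  have D_normal: "D \<lhd> G" unfolding D_def by (rule derived_self_is_normal)
  have conj: "inv h \<otimes> u \<otimes> h \<in> D" if "u \<in> D" "h \<in> carrier G" for u h
    using normal.inv_op_closed1[OF D_normal that(2,1)] .
  have w: "w \<in> D" unfolding D_def derived_def w_def using a b by (blast intro: generate.incl)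
  have abw: "a \<otimes> b = b \<otimes> a \<otimes> w"
    using a b by (simp add: w_def m_assoc)
  obtain \<phi> :: "int poly poly \<Rightarrow> 'a" where \<phi>: "ring_to_group G \<phi>" "\<phi> 1 = w"
    "ring_to_group.acts G \<phi> a [:[:0, 1:]:]" "ring_to_group.acts G \<phi> b [:0, 1:]"
    using two_variable_action[OF D_sub comm conj a b w abw] by metis
  interpret ring_to_group G \<phi> by (rule \<phi>(1))
  define A :: "int poly poly" where "A = [:[:0, 1:]:]"
  define B :: "int poly poly" where "B = [:0, 1:]"
  have actA: "acts a A" and actB: "acts b B" using \<phi>(3,4) by (simp_all add: A_def B_def)
  have ab: "a \<otimes> b = b \<otimes> (a \<otimes> \<phi> 1)" using abw \<phi>(2) a b DG[OF w] by (simp add: m_assoc)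
  have ba: "b \<otimes> a = a \<otimes> (b \<otimes> \<phi> (- 1))"
    using ab a b by (metis phi_closed phi_uminus inv_solve_right m_assoc m_closed inv_closed)
  define I where "I = {f. \<phi> f = \<one>}"
  have kill: "\<phi> (\<Gamma> * f) = \<one>" if "acts g \<Gamma>" "\<phi> f = \<one>" for g \<Gamma> f
  proof -
    have "g \<otimes> \<phi> (\<Gamma> * f) = g"
      using actsD(2)[OF that(1), of f] actsD(1)[OF that(1)] that(2) by simp
    then show ?thesis using actsD(1)[OF that(1)] by simp
  qed
  \<comment> \<open>The kernel of \<open>\<phi>\<close> is closed under \<open>A\<close> and
    \<open>B\<close> because conjugation fixes the identity, and under integers because
    \<open>\<phi>\<close> is additive; these generate the ring.\<close>
  interpret I: ring_ideal I
  proof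
    show "0 \<in> I" by (simp add: I_def)
    show "f + g \<in> I" if "f \<in> I" "g \<in> I" for f g using that by (simp add: I_def phi_add)
    fix f h assume "f \<in> I"
    then have f: "\<phi> f = \<one>" by (simp add: I_def)
    have of_int: "\<phi> (of_int c * f) = \<one>" for c
    proof (cases c)
      case (nonneg n)
      then show ?thesis using f by (simp add: phi_of_nat)
    next
      case (neg n)
      then have "of_int c = - (of_nat (Suc n) :: int poly poly)"
        by (simp only: of_int_minus of_int_of_nat_eq)
      then have "of_int c * f = - (of_nat (Suc n) * f)" by (simp only: mult_minus_left)
      then show ?thesis using f by (simp only: phi_uminus phi_of_nat) simp
    qed
    have smult: "\<phi> (Polynomial.smult q f) = \<one>" for q
    proof (induction q)
      case (pCons c q)
      have "Polynomial.smult (pCons c q) f = of_int c * f + A * Polynomial.smult q f"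
        by (simp add: A_def of_int_poly smult_add_left[symmetric])
      then show ?case using kill[OF actA pCons(2)] of_int[of c] by (simp only: phi_add l_one one_closed)
    qed simp
    have "\<phi> (h * f) = \<one>"
    proof (induction h)
      case (pCons q h)
      have "pCons q h * f = Polynomial.smult q f + B * (h * f)" by (simp add: B_def)
      then show ?case using kill[OF actB pCons(2)] smult[of q] by (simp only: phi_add l_one one_closed)
    qed simp
    then show "h * f \<in> I" by (simp add: I_def)
  qed
  have acts_ab: "acts (a [^] k \<otimes> b [^] l) (A ^ k * B ^ l)" for k l :: nat
    by (intro acts_mult acts_pow actA actB)
  have psum_I: "psum p (A ^ k * B ^ l) * f \<in> I \<longleftrightarrow> of_nat p * f \<in> I" for k l f
  proof -
    let ?g = "a [^] k \<otimes> b [^] l"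
    have g: "?g \<in> carrier G" using a b by simp
    have "(?g \<otimes> \<phi> f) [^] p = ?g [^] p \<longleftrightarrow> \<phi> f [^] p = \<one>"
      by (rule semi_p_mult_right[OF semi g phi_closed])
    then show ?thesis using g by (simp add: mult_phi_pow[OF acts_ab] I_def phi_of_nat)
  qed
  let ?NA = "psum p A" and ?NB = "psum p B"
  have psum_AB: "?NA * f \<in> I \<longleftrightarrow> of_nat p * f \<in> I" "?NB * f \<in> I \<longleftrightarrow> of_nat p * f \<in> I" for f
    using psum_I[of 1 0 f] psum_I[of 0 1 f] by simp_all
  define \<beta> where "\<beta> = (b [^] p) [^] \<delta>"
  define z where "z = a [^] p \<otimes> \<beta>"
  have \<beta>: "\<beta> \<in> carrier G" "\<beta> \<otimes> b = b \<otimes> \<beta>"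
    using b intertwine_pow[of b b b "p * \<delta>"] by (simp_all add: \<beta>_def nat_pow_pow)
  have z: "z \<in> carrier G" "z [^] p = \<one>" using a \<beta> z1 by (simp_all add: z_def \<beta>_def)
  have apb: "a [^] p \<otimes> b = b \<otimes> (a [^] p \<otimes> \<phi> ?NA)"
    using intertwine_pow[of b a "a \<otimes> \<phi> 1" p] ab a b mult_phi_pow[OF actA, of 1 p] by simp
  have bpa: "b [^] p \<otimes> a = a \<otimes> (b [^] p \<otimes> \<phi> (- ?NB))"
    using intertwine_pow[of a b "b \<otimes> \<phi> (- 1)" p] ba a b mult_phi_pow[OF actB, of "- 1" p] by simp
  \<comment> \<open>Since \<open>a^(p^2)\<close> is inverse to \<open>\<beta>^p\<close>, it commutes
    with \<open>b\<close>. Conjugating \<open>a^p\<close> by \<open>b\<close> multiplies it by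
    \<open>\<phi> ?NA\<close>, so this factor does not change the \<open>p\<close>th power and
    therefore has \<open>p\<close>th power one. Trading the norm for \<open>p\<close> gives the
    claim.\<close>
  have p2: "of_nat p * of_nat p \<in> I"
  proof -
    let ?r = "(a [^] p) [^] p" and ?q = "\<beta> [^] p"
    have r: "?r \<in> carrier G" and q: "?q \<in> carrier G" using a \<beta> by simp_all
    have rq: "?r \<otimes> ?q = \<one>"
      using semi_pi_abelianD[OF semi, of "a [^] p" \<beta>] z a \<beta> by (simp add: z_def)
    then have "?q = inv ?r" using r q by (metis inv_equality inv_inv inv_closed)
    moreover have "?q \<otimes> b = b \<otimes> ?q" using intertwine_pow[of b \<beta> \<beta> p] \<beta> b by simp
    ultimately have "?r \<otimes> b = b \<otimes> ?r"
      using r b by (metis inv_closed inv_solve_left inv_solve_right m_assoc m_closed)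
    moreover have "?r \<otimes> b = b \<otimes> (a [^] p \<otimes> \<phi> ?NA) [^] p"
      using intertwine_pow[of b "a [^] p" "a [^] p \<otimes> \<phi> ?NA" p] apb a b by simp
    ultimately have "(a [^] p \<otimes> \<phi> ?NA) [^] p = ?r" using a b r by simp
    then have "\<phi> ?NA [^] p = \<one>"
      using semi_p_mult_right[OF semi, of "a [^] p" "\<phi> ?NA"] a by simp
    then have "of_nat p * ?NA \<in> I" by (simp add: I_def phi_of_nat)
    then show ?thesis using psum_AB(1)[of "of_nat p"] by (simp add: mult.commute)
  qed
  have pN: "of_nat p * ?NA \<in> I" "of_nat p * ?NB \<in> I"
    using psum_AB[of "of_nat p"] p2 by (simp_all add: mult.commute)
  \<comment> \<open>The factorization \<open>A^p - 1 = (A - 1) ?NA\<close> shows that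
    \<open>a^p\<close>, and likewise \<open>b^p\<close>, centralizes every \<open>\<phi> s\<close>
    killed by \<open>p\<close>. Hence so does \<open>z\<close>.\<close>
  have fix_pow: "\<phi> (A ^ p * s) = \<phi> s" "\<phi> (B ^ p * s) = \<phi> s" if "of_nat p * s \<in> I" for s
  proof -
    have "A ^ p * s = (A - 1) * (?NA * s) + s" "B ^ p * s = (B - 1) * (?NB * s) + s"
      using psum_mult_diff[of A p] psum_mult_diff[of B p]
      by (simp_all add: mult.assoc[symmetric] left_diff_distrib)
    moreover have "(A - 1) * (?NA * s) \<in> I" "(B - 1) * (?NB * s) \<in> I"
      using that psum_AB by (auto intro: I.mult_I)
    ultimately show "\<phi> (A ^ p * s) = \<phi> s" "\<phi> (B ^ p * s) = \<phi> s"
      by (simp_all add: phi_add I_def)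
  qed
  have comm_\<beta>: "\<phi> s \<otimes> \<beta> = \<beta> \<otimes> \<phi> s" if "of_nat p * s \<in> I" for s
  proof (cases "\<delta> = 0")
    case False
    then have "\<beta> = b [^] p" using \<delta> b by (simp add: \<beta>_def le_Suc_eq)
    then show ?thesis using actsD(2)[OF acts_pow[OF actB], of s p] fix_pow(2)[OF that] by simp
  qed (simp add: \<beta>_def)
  have comm_z: "\<phi> s \<otimes> z = z \<otimes> \<phi> s" if s: "of_nat p * s \<in> I" for s
  proof -
    have "\<phi> s \<otimes> z = (\<phi> s \<otimes> a [^] p) \<otimes> \<beta>" using a \<beta> by (simp add: z_def m_assoc)
    also have "\<dots> = a [^] p \<otimes> (\<phi> s \<otimes> \<beta>)"
      using actsD(2)[OF acts_pow[OF actA], of s p] fix_pow(1)[OF s] a \<beta> by (simp add: m_assoc)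
    also have "\<dots> = z \<otimes> \<phi> s" unfolding comm_\<beta>[OF s] using a \<beta> by (simp add: z_def m_assoc)
    finally show ?thesis .
  qed
  have zb: "z \<otimes> b = b \<otimes> z \<otimes> \<phi> ?NA"
  proof -
    have "z \<otimes> b = (a [^] p \<otimes> b) \<otimes> \<beta>" using a b \<beta> by (simp add: z_def m_assoc)
    also have "\<dots> = b \<otimes> a [^] p \<otimes> (\<phi> ?NA \<otimes> \<beta>)" unfolding apb using a b \<beta> by (simp add: m_assoc)
    also have "\<dots> = b \<otimes> z \<otimes> \<phi> ?NA"
      unfolding comm_\<beta>[OF pN(1)] using a b \<beta> by (simp add: z_def m_assoc)
    finally show ?thesis .
  qed
  define s where "s = - (of_nat \<delta> * ?NB)"
  have za: "z \<otimes> a = a \<otimes> z \<otimes> \<phi> s"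
  proof (cases "\<delta> = 0")
    case True
    then show ?thesis using a intertwine_pow[of a a a p] by (simp add: z_def \<beta>_def s_def)
  next
    case False
    then have d: "\<delta> = 1" using \<delta> by simp
    then have "z \<otimes> a = a [^] p \<otimes> (b [^] p \<otimes> a)" using a b by (simp add: z_def \<beta>_def m_assoc)
    also have "\<dots> = (a [^] p \<otimes> a) \<otimes> b [^] p \<otimes> \<phi> (- ?NB)" unfolding bpa using a b by (simp add: m_assoc)
    also have "a [^] p \<otimes> a = a \<otimes> a [^] p" using a intertwine_pow[of a a a p] by simp
    finally show ?thesis using d a b by (simp add: z_def \<beta>_def s_def m_assoc)
  qed
  interpret P: power_ideal I A B p \<delta>
  proof
    show "Factorial_Ring.prime p" by (rule p)
    show "of_nat p * of_nat p \<in> I" by (rule p2)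
    show "psum p (A ^ k * B ^ l) * f \<in> I \<longleftrightarrow> of_nat p * f \<in> I" for k l f by (rule psum_I)
    fix k
    let ?g = "a [^] k \<otimes> b" and ?\<zeta> = "?NA - of_nat \<delta> * B * ?NB * psum k A"
    have g: "?g \<in> carrier G" "acts ?g (A ^ k * B)"
      using a b by (auto intro: acts_mult acts_pow actA actB)
    have "of_nat p * ?\<zeta> = of_nat p * ?NA - of_nat \<delta> * B * psum k A * (of_nat p * ?NB)"
      by (simp add: algebra_simps)
    then have p\<zeta>: "of_nat p * ?\<zeta> \<in> I" using pN by (auto intro: I.diff_I I.mult_I)
    \<comment> \<open>The commutator of \<open>z\<close> with \<open>a^k b\<close>: moving
      \<open>z\<close> past \<open>a^k\<close> produces \<open>s * psum k A\<close>, which picks up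
      \<open>B\<close> on passing \<open>b\<close>, and moving \<open>z\<close> past
      \<open>b\<close> adds \<open>?NA\<close>.\<close>
    have \<zeta>: "?\<zeta> = ?NA + B * (s * psum k A)" by (simp add: s_def mult_ac)
    have "z \<otimes> ?g = (z \<otimes> a [^] k) \<otimes> b" using a b z by (simp add: m_assoc)
    also have "\<dots> = a [^] k \<otimes> z \<otimes> (\<phi> (s * psum k A) \<otimes> b)"
      unfolding commute_pow[OF actA z(1) za] using a b z by (simp add: m_assoc)
    also have "\<dots> = a [^] k \<otimes> (z \<otimes> b) \<otimes> \<phi> (B * (s * psum k A))"
      using a b z by (simp add: actsD(2)[OF actB] m_assoc)
    also have "\<dots> = ?g \<otimes> z \<otimes> \<phi> ?\<zeta>"
      unfolding zb \<zeta> phi_add using a b z by (simp add: m_assoc)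
    finally have zg: "z \<otimes> ?g = ?g \<otimes> z \<otimes> \<phi> ?\<zeta>" .
    \<comment> \<open>As \<open>z\<close> centralizes these elements, the collection formula is used
      with \<open>V = 1\<close>, which leaves the plain double sum.\<close>
    have "\<phi> (?\<zeta> * f) \<otimes> z = z \<otimes> \<phi> (1 * (?\<zeta> * f))" for f
      using comm_z[of "?\<zeta> * f"] I.mult_I'[OF p\<zeta>, of f] by (simp add: mult.assoc)
    from mult_pow[OF g(2) z(1) zg this, of p]
    have "(?g \<otimes> z) [^] p = ?g [^] p \<otimes> \<phi> (?\<zeta> * (\<Sum>i<p. psum i (A ^ k * B)))"
      using z g(1) by simp
    moreover have "(?g \<otimes> z) [^] p = ?g [^] p"
      using semi_p_mult_right[OF semi g(1) z(1)] z(2) by simp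
    ultimately show "?\<zeta> * (\<Sum>i<p. psum i (A ^ k * B)) \<in> I"
      using g(1) by (simp add: I_def)
  qed
  define E where "E = (\<Sum>i<p. B ^ i * psum i A)"
  have "A \<noteq> 1" by (simp add: A_def one_pCons)
  from P.p_commutator_sum_I[OF commutator_sum_decomp[OF p this]]
  have E: "of_nat p * E \<in> I" by (simp add: E_def)
  have "\<phi> (- 1 * E) [^] p = \<phi> (- 1 * (of_nat p * E))" by (simp add: phi_of_nat[symmetric])
  then have "\<phi> (- 1 * E) [^] p = \<one>" using I.mult_I[OF E, of "- 1"] unfolding I_def by simp
  moreover have "(a \<otimes> b) [^] p = a [^] p \<otimes> b [^] p \<otimes> \<phi> (- 1 * E)"
    unfolding E_def
  proof (rule mult_pow[OF actA b])
    show "b \<otimes> a = a \<otimes> b \<otimes> \<phi> (- 1)" using ba a b by (simp add: m_assoc)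
    show "\<phi> (- 1 * f) \<otimes> b = b \<otimes> \<phi> (B * (- 1 * f))" for f by (rule actsD(2)[OF actB])
  qed
  ultimately show ?thesis using phi_closed by blast
qed

lemma semi_p2_abelian:
  assumes p: "Factorial_Ring.prime p"
    and metab: "derived G (derived G (carrier G)) = {\<one>}"
    and semi: "semi_pi_abelian G p 1"
  shows "semi_pi_abelian G p 2"
proof -
  have pow2: "x [^] (p ^ 2) = (x [^] p) [^] p" if "x \<in> carrier G" for x
    using that by (simp add: nat_pow_pow power2_eq_square)
  have mult1: "(x \<otimes> y) [^] p = \<one>"
    if "x \<in> carrier G" "y \<in> carrier G" "x [^] p = \<one>" "y [^] p = \<one>" for x y
    using semi_p_mult_left[OF semi that(2,1,3)] that(4) by simp
  have imp: "(a \<otimes> b) [^] (p ^ 2) = \<one>"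
    if a: "a \<in> carrier G" and b: "b \<in> carrier G" and eq: "a [^] (p ^ 2) \<otimes> b [^] (p ^ 2) = \<one>" for a b
  proof -
    have z: "(a [^] p \<otimes> b [^] p) [^] p = \<one>"
      using semi_pi_abelianD[OF semi, of "a [^] p" "b [^] p"] eq a b by (simp add: pow2)
    have "(a [^] p \<otimes> (b [^] p) [^] (1::nat)) [^] p = \<one>"
      using z nat_pow_eone[OF nat_pow_closed[OF b]] by metis
    then obtain e where e: "e \<in> carrier G" "e [^] p = \<one>" "(a \<otimes> b) [^] p = a [^] p \<otimes> b [^] p \<otimes> e"
      using pow_p_mult_eq[OF p metab semi a b order_refl] by blast
    then show ?thesis using mult1[OF _ e(1) z e(2)] a b by (simp add: pow2)
  qed
  have conv: "a [^] (p ^ 2) \<otimes> b [^] (p ^ 2) = \<one>"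
    if a: "a \<in> carrier G" and b: "b \<in> carrier G" and eq: "(a \<otimes> b) [^] (p ^ 2) = \<one>" for a b
  proof -
    \<comment> \<open>What is known here is that \<open>(a b)^p\<close> has \<open>p\<close>th power
      one. Writing \<open>a = ?c ?d\<close> puts \<open>?c [^] p\<close> in the role of
      \<open>z\<close>, so \<open>\<delta> = 0\<close>; factors with trivial \<open>p\<close>th
      power are then dropped on either side.\<close>
    let ?c = "a \<otimes> b" and ?d = "inv b"
    have c: "?c \<in> carrier G" and d: "?d \<in> carrier G" using a b by simp_all
    have c1: "(?c [^] p) [^] p = \<one>" using eq c by (simp add: pow2)
    have "(?c [^] p \<otimes> (?d [^] p) [^] (0::nat)) [^] p = \<one>" using c1 c by simp
    then obtain e where e: "e \<in> carrier G" "e [^] p = \<one>" "(?c \<otimes> ?d) [^] p = ?c [^] p \<otimes> ?d [^] p \<otimes> e"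
      using pow_p_mult_eq[OF p metab semi c d le0] by blast
    have "a [^] p = ?c [^] p \<otimes> (?d [^] p \<otimes> e)"
      using e a b c d by (simp add: m_assoc)
    then have "(a [^] p) [^] p = (?d [^] p \<otimes> e) [^] p"
      using semi_p_mult_left[OF semi _ _ c1] c d e by simp
    also have "\<dots> = (?d [^] p) [^] p"
      using semi_p_mult_right[OF semi _ e(1)] d e(2) by simp
    finally show ?thesis using a b by (simp add: pow2 nat_pow_inv)
  qed
  show ?thesis unfolding semi_pi_abelian_def using imp conv by blast
qed

text \<open>Exponent \<open>i\<close> makes \<open>N\<close> a subgroup and relates levels of the
  quotient to levels of \<open>G\<close>. Exponent \<open>Suc i\<close> then says that the quotient
  is semi-p-abelian, and its second level is level \<open>i + 2\<close> of \<open>G\<close>.\<close>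

lemma semi_pi_abelian_Suc_Suc:
  assumes p: "Factorial_Ring.prime p"
    and metab: "derived G (derived G (carrier G)) = {\<one>}"
    and i: "semi_pi_abelian G p i" and Si: "semi_pi_abelian G p (Suc i)"
  shows "semi_pi_abelian G p (Suc (Suc i))"
proof -
  define N where "N = {x \<in> carrier G. x [^] (p ^ i) = \<one>}"
  have pow_conj: "(h \<otimes> x \<otimes> inv h) [^] n = h \<otimes> x [^] n \<otimes> inv h"
    if "x \<in> carrier G" "h \<in> carrier G" for x h and n :: nat
  proof -
    have "(h \<otimes> x \<otimes> inv h) [^] n \<otimes> h = h \<otimes> x [^] n"
      by (rule intertwine_pow) (use that in \<open>simp_all add: m_assoc\<close>)
    then show ?thesis using that by (metis inv_closed inv_solve_right m_closed nat_pow_closed)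
  qed
  have sub: "subgroup N G"
  proof
    show "N \<subseteq> carrier G" by (auto simp: N_def)
    show "x \<otimes> y \<in> N" if "x \<in> N" "y \<in> N" for x y
      using that semi_pi_abelianD[OF i, of x y] by (auto simp: N_def)
    show "\<one> \<in> N" by (simp add: N_def)
    show "inv x \<in> N" if "x \<in> N" for x using that by (auto simp: N_def nat_pow_inv)
  qed
  have N: "N \<lhd> G"
    unfolding normal_inv_iff using sub by (auto simp: N_def pow_conj)
  have Q: "group (G Mod N)" using N by (rule normal.factorgroup_is_group)
  have h: "group_hom G (G Mod N) (\<lambda>x. N #> x)"
    using normal.r_coset_hom_Mod[OF N] Q by (simp add: group_hom_def group_hom_axioms_def is_group)
  note h_mult = group_hom.hom_mult[OF h] and h_pow = group_hom.hom_nat_pow[OF h]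
  have surj: "carrier (G Mod N) = (\<lambda>x. N #> x) ` carrier G"
    by (auto simp: FactGroup_def RCOSETS_def)
  have one: "N #> x = \<one>\<^bsub>G Mod N\<^esub> \<longleftrightarrow> x [^] (p ^ i) = \<one>" if "x \<in> carrier G" for x
  proof -
    have "N #> x = N \<longleftrightarrow> x \<in> N"
      using that sub by (metis coset_join1 coset_join2 subgroup.subset)
    moreover have "x \<in> N \<longleftrightarrow> x [^] (p ^ i) = \<one>" using that by (simp add: N_def)
    ultimately show ?thesis by (simp only: one_FactGroup)
  qed
  \<comment> \<open>A coset is trivial iff the \<open>p^i\<close>th power of a representative is
    one. For the product of two \<open>p^j\<close>th powers, the hypothesis at \<open>i\<close>
    replaces that power by a product of powers.\<close>
  have trans: "semi_pi_abelian (G Mod N) p j \<longleftrightarrow> semi_pi_abelian G p (i + j)" for j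
  proof -
    have 1: "((N #> a) \<otimes>\<^bsub>G Mod N\<^esub> (N #> b)) [^]\<^bsub>G Mod N\<^esub> (p ^ j) = \<one>\<^bsub>G Mod N\<^esub>
        \<longleftrightarrow> (a \<otimes> b) [^] (p ^ (i + j)) = \<one>"
      and 2: "(N #> a) [^]\<^bsub>G Mod N\<^esub> (p ^ j) \<otimes>\<^bsub>G Mod N\<^esub> (N #> b) [^]\<^bsub>G Mod N\<^esub> (p ^ j) = \<one>\<^bsub>G Mod N\<^esub>
        \<longleftrightarrow> a [^] (p ^ (i + j)) \<otimes> b [^] (p ^ (i + j)) = \<one>"
      if "a \<in> carrier G" "b \<in> carrier G" for a b
    proof -
      have "((N #> a) \<otimes>\<^bsub>G Mod N\<^esub> (N #> b)) [^]\<^bsub>G Mod N\<^esub> (p ^ j) = N #> ((a \<otimes> b) [^] (p ^ j))"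
        using that by (simp only: h_mult[symmetric] h_pow[symmetric] m_closed nat_pow_closed)
      then show "((N #> a) \<otimes>\<^bsub>G Mod N\<^esub> (N #> b)) [^]\<^bsub>G Mod N\<^esub> (p ^ j) = \<one>\<^bsub>G Mod N\<^esub>
        \<longleftrightarrow> (a \<otimes> b) [^] (p ^ (i + j)) = \<one>"
        using one[of "(a \<otimes> b) [^] (p ^ j)"] that by (simp add: nat_pow_pow power_add mult.commute)
      have "(N #> a) [^]\<^bsub>G Mod N\<^esub> (p ^ j) \<otimes>\<^bsub>G Mod N\<^esub> (N #> b) [^]\<^bsub>G Mod N\<^esub> (p ^ j)
          = N #> (a [^] (p ^ j) \<otimes> b [^] (p ^ j))"
        using that by (simp only: h_mult[symmetric] h_pow[symmetric] m_closed nat_pow_closed)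
      moreover have "(a [^] (p ^ j) \<otimes> b [^] (p ^ j)) [^] (p ^ i) = \<one> \<longleftrightarrow>
          a [^] (p ^ (i + j)) \<otimes> b [^] (p ^ (i + j)) = \<one>"
        using semi_pi_abelianD[OF i, of "a [^] (p ^ j)" "b [^] (p ^ j)"] that
        by (simp add: nat_pow_pow power_add mult.commute)
      ultimately show "(N #> a) [^]\<^bsub>G Mod N\<^esub> (p ^ j) \<otimes>\<^bsub>G Mod N\<^esub> (N #> b) [^]\<^bsub>G Mod N\<^esub> (p ^ j) = \<one>\<^bsub>G Mod N\<^esub>
        \<longleftrightarrow> a [^] (p ^ (i + j)) \<otimes> b [^] (p ^ (i + j)) = \<one>"
        using one[of "a [^] (p ^ j) \<otimes> b [^] (p ^ j)"] that by simp
    qed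
    show ?thesis unfolding semi_pi_abelian_def surj ball_simps using 1 2 by simp
  qed
  have "derived (G Mod N) (derived (G Mod N) (carrier (G Mod N))) = {\<one>\<^bsub>G Mod N\<^esub>}"
  proof -
    have "derived (G Mod N) (carrier (G Mod N)) = (\<lambda>x. N #> x) ` derived G (carrier G)"
      unfolding surj by (rule group_hom.derived_img[OF h]) simp
    then have "derived (G Mod N) (derived (G Mod N) (carrier (G Mod N)))
        = (\<lambda>x. N #> x) ` derived G (derived G (carrier G))"
      by (simp only:) (rule group_hom.derived_img[OF h], rule derived_in_carrier, simp)
    then show ?thesis unfolding metab using group_hom.hom_one[OF h] by simp
  qed
  moreover have "semi_pi_abelian (G Mod N) p 1" using Si trans[of 1] by simp
  ultimately have "semi_pi_abelian (G Mod N) p 2" using group.semi_p2_abelian[OF Q p] by blast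
  then show ?thesis using trans[of 2] by simp
qed

end

theorem theorem1p3:
  fixes G :: "('a, 'b) monoid_scheme" and p :: nat
  assumes "Factorial_Ring.prime p"
    and "group G"
    and "finite (carrier G)"
    and "\<exists>n::nat. order G = p ^ n"
    and "derived G (derived G (carrier G)) = {\<one>\<^bsub>G\<^esub>}"
    and "semi_pi_abelian G p 1"
  shows "strongly_semi_p_abelian G p"
proof -
  interpret group G by (rule assms(2))
  \<comment> \<open>The step consumes two consecutive exponents, so a pair is carried along; it
    starts at exponent zero, where \<open>p^0 = 1\<close> makes the condition a tautology.\<close>
  have "semi_pi_abelian G p i \<and> semi_pi_abelian G p (Suc i)" for i
  proof (induction i)
    case 0
    show ?case using assms(6) by (auto simp: semi_pi_abelian_def)
  next
    case (Suc i)
    then show ?case using semi_pi_abelian_Suc_Suc[OF assms(1,5)] by blast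
  qed
  then show ?thesis by (simp add: strongly_semi_p_abelian_def)
qed

end
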